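(* If $M$ is a filling of a left-aligned stack polyomino $\mathcal{M}$ and $\phi$ is the map on fillings of left-aligned stack polyominoes defined in the context, then $\mathrm{maj}(M)=\mathrm{ne}(\phi(M))$.
   Context: **Polyominoes.** A polyomino is a finite subset of $\mathbb{Z}^2$ whose elements are drawn as square cells. It is convex if its intersection with any row or column is connected, and intersection-free if any two of its columns are comparable, i.e. the set of row-coordinates of one is contained in that of the other. A moon polyomino is a convex intersection-free polyomino. A moon polyomino whose rows are left-aligned is a left-aligned stack polyomino; a moon polyomino whose rows are left-aligned and columns are top-aligned is a Ferrers diagram. **Fillings.** A filling of a moon polyomino $\mathcal{M}$ assigns $0$ or $1$ to each cell with at most one $1$ in each row; a 1-cell is a cell assigned $1$; a row is empty if it contains no 1-cell. An NE chain is a pair of 1-cells, one strictly above and strictly to the right of the other, such that the smallest rectangle containing them is contained in $\mathcal{M}$; $\mathrm{ne}(M)$ is the number of NE chains. **Major index.** For a filling $R$ of a rectangle with nonempty rows $r_1,\dots,r_n$ from top to bottom, $\mathrm{des}(R)$ is the number of $i$ such that the 1-cells of $r_i$ and $r_{i+1}$ form an NE chain; $R(r_i)$ is the restriction of $R$ to the row $r_i$ and all rows above it; $\mathrm{maj}(R)=\sum_{i=1}^n\mathrm{des}(R(r_i))$. For a filling $M$ of a moon polyomino $\mathcal{M}$, let $\mathcal{R}_1,\dots,\mathcal{R}_r$ be all the maximal rectangles contained in $\mathcal{M}$, ordered increasingly by height, and $R_i$ the restriction of $M$ to $\mathcal{R}_i$. Then $\mathrm{maj}(M)=\sum_{i=1}^r\mathrm{maj}(R_i)-\sum_{i=1}^{r-1}\mathrm{maj}(R_i\cap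 R_{i+1})$. **Swapping.** Swapping 1-cells at (row, column) positions $(i_1,j_1)$ and $(i_2,j_2)$ means deleting these two 1's and writing 1's at $(i_1,j_2)$ and $(i_2,j_1)$. $col(D)$ is the column of a cell $D$, $|col(D)|$ its length. **The algorithm $\gamma_r$.** Let $G$ be a filling without empty rows of a Ferrers diagram, and $r$ a row (left-aligned, at least as long as the top row of $G$) placed on top of $G$, with 1-cell $C$. Let $\mathcal{R}$ be the set of rows of $G$ that intersect the column of $C$. 1-cells in $\mathcal{R}$ strictly to the left of $C$ are called left; those weakly to the right of $C$ are called right. Let $CLC$ be the topmost left 1-cell and $CRC$ the leftmost right 1-cell above $CLC$ (the lowest such if there are several). $\mathcal{R}_1$ is the set of rows weakly below the row of $CRC$ that intersect the column of $CRC$; $\mathcal{R}_2$ is the set of rows in $\mathcal{R}$ that do not intersect the column of $CRC$. If $CLC$ does not exist, $\mathcal{R}_1=\mathcal{R}_2=\emptyset$; if $CLC$ exists but $CRC$ does not, $\mathcal{R}_1=\emptyset$ and $\mathcal{R}_2$ is the set of rows in $\mathcal{R}$ weakly below $CLC$. First perform $\gamma_r^1$ on $\mathcal{R}_1$, then $\gamma_r^2$ on $\mathcal{R}_2$ (each does nothing if its set of rows is empty). $\gamma_r^1$: (A) Set $ptr_1$ on the highest row of $\mathcal{R}_1$ and $ptr_2$ on the next row of $\mathcal{R}_1$ below. (B) If $ptr_2$ is null, stop. Otherwise let $C_1,C_2$ be the 1-cells in the rows of $ptr_1,ptr_2$. (B1) If $C_2$ is left, swap $C_1$ and $C_2$ and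 move $ptr_1$ to the row of $ptr_2$. (B2) If $C_2$ is right: (B2.1) if $|col(C_1)|=|col(C_2)|$, move $ptr_1$ to the row of $ptr_2$; (B2.2) if $C_1$ is to the left of $C_2$ and $|col(C_1)|>|col(C_2)|$, do nothing; (B2.3) if $C_1$ is to the right of $C_2$ and $|col(C_1)|<|col(C_2)|$, let $L$ be the lowest left 1-cell above $C_1$; if $L,C_1,C_2$ are at $(i_1,j_1),(i_2,j_2),(i_3,j_3)$, delete these three 1's and write 1's at $(i_1,j_3),(i_2,j_1),(i_3,j_2)$; move $ptr_1$ to the row of $ptr_2$. (C) Move $ptr_2$ to the next row of $\mathcal{R}_1$ below and go to (B). $\gamma_r^2$: (A$'$) Set $ptr_1$ on the highest row of $\mathcal{R}_2$ and $ptr_2$ on the next row of $\mathcal{R}_2$ below. (B$'$) (Borrowing) If $ptr_1$ points to a right 1-cell, find the lowest left 1-cell above it and swap them. (C$'$) If $ptr_2$ is null, stop. Otherwise let $C_1,C_2$ be the 1-cells in the rows of $ptr_1,ptr_2$; if $C_2$ is right, swap $C_1$ and $C_2$; if $C_2$ is left, do nothing. (D$'$) Move $ptr_1$ to the row of $ptr_2$ and $ptr_2$ to the next row of $\mathcal{R}_2$ below; go to (C$'$). **The map $\phi$ on fillings of left-aligned stack polyominoes.** Empty rows are deleted first and reinserted at the end. For a filling $M$ without empty rows: if $M$ has one row, $\phi(M)=M$. Otherwise let $r$ be the top row of $M$, $\mathcal{F}$ the maximal Ferrers diagram contained in the shape that contains the top row, and $\mathcal{F}_1$ be $\mathcal{F}$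 without its top row. Let $M_1=M\setminus r$ and $M_1'=\phi(M_1)$; apply $\gamma_r$ to $M_1'\cap\mathcal{F}_1$ (ignoring rows of $\mathcal{F}_1$ containing no 1 of $M_1'\cap\mathcal{F}_1$), leaving the rest of $M_1'$ unchanged, to get $M_2$; $\phi(M)$ is $M_2$ with the row $r$ added back on top. *)

theory Defs
  imports Main
begin

text \<open>
  A cell is a pair \<open>(i, j)\<close> of a row index and a column index in matrix convention:
  row indices increase downwards and column indices increase to the right, so \<open>i < i'\<close> means that
  row \<open>i\<close> is above row \<open>i'\<close>, and ascending row indices list rows from top to bottom.
\<close>

type_synonym cell = "int \<times> int"

definition rows :: "cell set \<Rightarrow> int set" where
  "rows P = fst ` P"

definition row_of :: "cell set \<Rightarrow> int \<Rightarrow> int set" where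
  "row_of P i = {j. (i, j) \<in> P}"

definition column_of :: "cell set \<Rightarrow> int \<Rightarrow> int set" where
  "column_of P j = {i. (i, j) \<in> P}"

definition connected_line :: "int set \<Rightarrow> bool" where
  "connected_line A \<longleftrightarrow> (\<forall>x\<in>A. \<forall>y\<in>A. {x..y} \<subseteq> A)"

definition convex_polyomino :: "cell set \<Rightarrow> bool" where
  "convex_polyomino P \<longleftrightarrow> finite P \<and>
     (\<forall>i. connected_line (row_of P i)) \<and> (\<forall>j. connected_line (column_of P j))"

definition intersection_free :: "cell set \<Rightarrow> bool" where
  "intersection_free P \<longleftrightarrow>
     (\<forall>j j'. column_of P j \<subseteq> column_of P j' \<or> column_of P j' \<subseteq> column_of P j)"

definition moon_polyomino :: "cell set \<Rightarrow> bool" where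
  "moon_polyomino P \<longleftrightarrow> convex_polyomino P \<and> intersection_free P"

definition left_aligned :: "cell set \<Rightarrow> bool" where
  "left_aligned P \<longleftrightarrow> (\<exists>c. \<forall>(i, j)\<in>P. c \<le> j \<and> (i, c) \<in> P)"

definition top_aligned :: "cell set \<Rightarrow> bool" where
  "top_aligned P \<longleftrightarrow> (\<exists>t. \<forall>(i, j)\<in>P. t \<le> i \<and> (t, j) \<in> P)"

definition left_aligned_stack :: "cell set \<Rightarrow> bool" where
  "left_aligned_stack P \<longleftrightarrow> moon_polyomino P \<and> left_aligned P"

definition ferrers :: "cell set \<Rightarrow> bool" where
  "ferrers P \<longleftrightarrow> moon_polyomino P \<and> left_aligned P \<and> top_aligned P"

text \<open>
  A 01-filling is represented by the set of its 1-cells; the restriction of a filling \<open>S\<close> to a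
  part \<open>R\<close> of its polyomino is then \<open>S \<inter> R\<close>.
\<close>

definition filling :: "cell set \<Rightarrow> cell set \<Rightarrow> bool" where
  "filling P S \<longleftrightarrow> S \<subseteq> P \<and> (\<forall>i j j'. (i, j) \<in> S \<and> (i, j') \<in> S \<longrightarrow> j = j')"

text \<open>The column of the 1-cell of a nonempty row \<open>i\<close>.\<close>

definition one_col :: "cell set \<Rightarrow> int \<Rightarrow> int" where
  "one_col S i = (THE j. (i, j) \<in> S)"

text \<open>In \<open>is_NE_chain P a b\<close> the upper right cell of the chain is \<open>a\<close>.\<close>

definition is_NE_chain :: "cell set \<Rightarrow> cell \<Rightarrow> cell \<Rightarrow> bool" where
  "is_NE_chain P a b \<longleftrightarrow>
     fst a < fst b \<and> snd b < snd a \<and> {fst a..fst b} \<times> {snd b..snd a} \<subseteq> P"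

definition ne :: "cell set \<Rightarrow> cell set \<Rightarrow> nat" where
  "ne P S = card {(a, b). a \<in> S \<and> b \<in> S \<and> is_NE_chain P a b}"


section \<open>Major index\<close>

text \<open>\<open>des\<close> and \<open>maj_rect\<close> are meant for fillings \<open>S\<close> of a rectangle \<open>P\<close>.\<close>

definition des :: "cell set \<Rightarrow> cell set \<Rightarrow> nat" where
  "des P S = (let rs = sorted_list_of_set (rows S) in
     card {k. Suc k < length rs \<and>
       is_NE_chain P (rs ! k, one_col S (rs ! k)) (rs ! Suc k, one_col S (rs ! Suc k))})"

definition upto_row :: "cell set \<Rightarrow> int \<Rightarrow> cell set" where
  "upto_row P r = {(i, j) \<in> P. i \<le> r}"

definition maj_rect :: "cell set \<Rightarrow> cell set \<Rightarrow> nat" where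
  "maj_rect P S = (\<Sum>r\<in>rows S. des (upto_row P r) (upto_row S r))"

definition rectangle :: "cell set \<Rightarrow> bool" where
  "rectangle R \<longleftrightarrow> (\<exists>a b c d. a \<le> b \<and> c \<le> d \<and> R = {a..b} \<times> {c..d})"

definition maximal_rectangles :: "cell set \<Rightarrow> cell set set" where
  "maximal_rectangles P =
     {R. rectangle R \<and> R \<subseteq> P \<and> (\<forall>R'. rectangle R' \<and> R' \<subseteq> P \<and> R \<subseteq> R' \<longrightarrow> R' = R)}"

definition height :: "cell set \<Rightarrow> nat" where
  "height R = card (rows R)"

text \<open>
  Distinct maximal rectangles of a moon polyomino have distinct heights, so the list of rectangles
  below is determined by the ordering by height.
\<close>

definition maj :: "cell set \<Rightarrow> cell set \<Rightarrow> int" where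
  "maj P S = (let Rs = sorted_key_list_of_set height (maximal_rectangles P) in
     (\<Sum>i<length Rs. int (maj_rect (Rs ! i) (S \<inter> Rs ! i)))
     - (\<Sum>i<length Rs - 1.
          int (maj_rect (Rs ! i \<inter> Rs ! Suc i) (S \<inter> (Rs ! i \<inter> Rs ! Suc i)))))"


section \<open>The algorithm \<open>\<gamma>\<^sub>r\<close>\<close>

text \<open>
  Throughout, \<open>D\<close> is the Ferrers diagram of the filling that \<open>\<gamma>\<^sub>r\<close> is applied to, every row of
  which contains a 1-cell, and \<open>c\<close> is the column of the 1-cell \<open>C\<close> of \<open>r\<close>. The set of
  rows \<open>\<R>\<close> is \<open>column_of D c\<close>; the 1-cell in a row of \<open>\<R>\<close> is left iff its column is less
  than \<open>c\<close>. A 1-cell is given by its row, and \<open>S\<close> is the current filling, so that left and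
  right always refer to the present positions of the 1-cells.
\<close>

definition col_length :: "cell set \<Rightarrow> int \<Rightarrow> nat" where
  "col_length D j = card (column_of D j)"

definition swap_rows :: "cell set \<Rightarrow> int \<Rightarrow> int \<Rightarrow> cell set" where
  "swap_rows S i1 i2 =
     (S - {(i1, one_col S i1), (i2, one_col S i2)}) \<union> {(i1, one_col S i2), (i2, one_col S i1)}"

definition rotate_rows :: "cell set \<Rightarrow> int \<Rightarrow> int \<Rightarrow> int \<Rightarrow> cell set" where
  "rotate_rows S i1 i2 i3 =
     (S - {(i1, one_col S i1), (i2, one_col S i2), (i3, one_col S i3)})
     \<union> {(i1, one_col S i3), (i2, one_col S i1), (i3, one_col S i2)}"

definition lowest_left_above :: "cell set \<Rightarrow> int \<Rightarrow> cell set \<Rightarrow> int \<Rightarrow> int" where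
  "lowest_left_above D c S i = Max {l \<in> column_of D c. l < i \<and> one_col S l < c}"

text \<open>
  In the loops, \<open>p1\<close> is the row of the first pointer and the list contains the row of the second
  pointer followed by the rows below it; the empty list stands for the null pointer. The last
  branch of \<open>gamma1_loop\<close> is the case in which the 1-cell of \<open>p1\<close> is to the left of that of
  \<open>p2\<close> and in a longer column, as columns of a Ferrers diagram weakly decrease in length from left
  to right.
\<close>

fun gamma1_loop :: "cell set \<Rightarrow> int \<Rightarrow> int \<Rightarrow> int list \<Rightarrow> cell set \<Rightarrow> cell set" where
  "gamma1_loop D c p1 [] S = S"
| "gamma1_loop D c p1 (p2 # ps) S =
    (let c1 = one_col S p1; c2 = one_col S p2 in
     if c2 < c then gamma1_loop D c p2 ps (swap_rows S p1 p2)
     else if col_length D c1 = col_length D c2 then gamma1_loop D c p2 ps S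
     else if c2 < c1 \<and> col_length D c1 < col_length D c2
       then gamma1_loop D c p2 ps (rotate_rows S (lowest_left_above D c S p1) p1 p2)
     else gamma1_loop D c p1 ps S)"

definition gamma1 :: "cell set \<Rightarrow> int \<Rightarrow> int set \<Rightarrow> cell set \<Rightarrow> cell set" where
  "gamma1 D c R1 S = (case sorted_list_of_set R1 of
     [] \<Rightarrow> S
   | p1 # ps \<Rightarrow> gamma1_loop D c p1 ps S)"

fun gamma2_loop :: "int \<Rightarrow> int \<Rightarrow> int list \<Rightarrow> cell set \<Rightarrow> cell set" where
  "gamma2_loop c p1 [] S = S"
| "gamma2_loop c p1 (p2 # ps) S =
    gamma2_loop c p2 ps (if c \<le> one_col S p2 then swap_rows S p1 p2 else S)"

definition gamma2 :: "cell set \<Rightarrow> int \<Rightarrow> int set \<Rightarrow> cell set \<Rightarrow> cell set" where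
  "gamma2 D c R2 S = (case sorted_list_of_set R2 of
     [] \<Rightarrow> S
   | p1 # ps \<Rightarrow> gamma2_loop c p1 ps
       (if c \<le> one_col S p1 then swap_rows S (lowest_left_above D c S p1) p1 else S))"

text \<open>
  Below, \<open>clc\<close> and \<open>crc\<close> are the rows of the cells \<open>CLC\<close> and \<open>CRC\<close>, \<open>cc\<close> is the column of
  \<open>CRC\<close>, and \<open>rights\<close> consists of the rows above \<open>CLC\<close> that contain a right 1-cell.
\<close>

definition gamma :: "cell set \<Rightarrow> int \<Rightarrow> cell set \<Rightarrow> cell set" where
  "gamma D c S =
    (let R = column_of D c;
         lefts = {i \<in> R. one_col S i < c};
         clc = Min lefts;
         rights = {i \<in> R. i < clc \<and> c \<le> one_col S i};
         cc = Min (one_col S ` rights);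
         crc = Max {i \<in> rights. one_col S i = cc};
         R1 = (if lefts = {} \<or> rights = {} then {} else {i \<in> column_of D cc. crc \<le> i});
         R2 = (if lefts = {} then {}
               else if rights = {} then {i \<in> R. clc \<le> i}
               else R - column_of D cc)
     in gamma2 D c R2 (gamma1 D c R1 S))"


section \<open>The map \<open>\<phi>\<close>\<close>

definition top_row_cells :: "cell set \<Rightarrow> cell set" where
  "top_row_cells P = {(i, j) \<in> P. i = Min (rows P)}"

definition top_ferrers :: "cell set \<Rightarrow> cell set" where
  "top_ferrers P = (GREATEST F. ferrers F \<and> F \<subseteq> P \<and> top_row_cells P \<subseteq> F)"

text \<open>
  \<open>phi_nonempty\<close> is \<open>\<phi>\<close> on fillings without empty rows. The rows of \<open>F1\<close> which contain no
  1-cell of \<open>N\<close> are removed from \<open>F1\<close> to give the diagram \<open>D\<close> for \<open>\<gamma>\<^sub>r\<close>; the remaining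
  rows keep their indices, as \<open>\<gamma>\<^sub>r\<close> depends only on their relative order.
\<close>

function phi_nonempty :: "cell set \<Rightarrow> cell set \<Rightarrow> cell set" where
  "phi_nonempty P S =
    (if card (rows P) \<le> 1 then S
     else
       let r = Min (rows P);
           F1 = top_ferrers P - top_row_cells P;
           M1' = phi_nonempty (P - top_row_cells P) {(i, j) \<in> S. i \<noteq> r};
           N = M1' \<inter> F1;
           D = {(i, j) \<in> F1. i \<in> rows N}
       in (M1' - F1) \<union> gamma D (one_col S r) N \<union> {(i, j) \<in> S. i = r})"
  by pat_completeness auto
termination
proof (relation "measure (\<lambda>(P, S). card (rows P))", goal_cases)
  case 1
  then show ?case by simp
next
  case (2 P S r)
  have fin: "finite (rows P)"
    using 2(1) by (metis card.infinite zero_le)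
  have ne: "rows P \<noteq> {}"
    using 2(1) by auto
  have "rows (P - top_row_cells P) \<subseteq> rows P - {Min (rows P)}"
    by (auto simp: rows_def top_row_cells_def)
  then have "rows (P - top_row_cells P) \<subset> rows P"
    using Min_in[OF fin ne] by auto
  then show ?case
    using psubset_card_mono[OF fin] by simp
qed

declare phi_nonempty.simps [simp del]

text \<open>
  Empty rows are deleted by closing up the gaps: with \<open>I\<close> the set of nonempty rows, row \<open>i \<in> I\<close>
  gets the new index \<open>row_rank I i\<close>. Reinserting the empty rows undoes this renumbering.
\<close>

definition row_rank :: "int set \<Rightarrow> int \<Rightarrow> int" where
  "row_rank I i = int (card {k \<in> I. k < i})"

definition keep_rows :: "int set \<Rightarrow> cell set \<Rightarrow> cell set" where
  "keep_rows I P = {(row_rank I i, j) | i j. i \<in> I \<and> (i, j) \<in> P}"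

definition reinsert_rows :: "int set \<Rightarrow> cell set \<Rightarrow> cell set" where
  "reinsert_rows I T = {(i, j). i \<in> I \<and> (row_rank I i, j) \<in> T}"

definition phi :: "cell set \<Rightarrow> cell set \<Rightarrow> cell set" where
  "phi P S = reinsert_rows (rows S) (phi_nonempty (keep_rows (rows S) P) (keep_rows (rows S) S))"

end

theory Submission
  imports Defs "HOL-Combinatorics.Permutations"
begin

text \<open>
  Induction on the number of rows. Let the top row have its 1-cell in column \<open>c\<close>. Swapping two
  1-cells, the upper one to the left of the lower one, raises the number of NE chains by exactly one
  if all 1-cells in the rows between them are further to the right. Every move of \<open>\<gamma>\<^sub>r\<close> is built
  from such swaps and their inverses: \<open>\<gamma>\<^sub>r\<^sup>1\<close> removes one chain per left cell of \<open>\<R>\<^sub>1\<close>, and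
  \<open>\<gamma>\<^sub>r\<^sup>2\<close> creates one per right cell of \<open>\<R>\<^sub>2\<close>. Since the top row is in one chain with each left cell, adding it after
  \<open>\<gamma>\<^sub>r\<close> raises \<open>ne\<close> by \<open>|\<R>\<^sub>2|\<close>.

  On the other side, adding a row on top of a filling \<open>X\<close> of a rectangle raises the major index by
  \<open>|X|\<close> if the topmost 1-cell of \<open>X\<close> is to the left of column \<open>c\<close>, and by 0 otherwise. Summed over
  the rectangles of the stack polyomino this telescopes to \<open>|\<R>\<^sub>2|\<close> as well. The induction also has to
  carry along that \<open>\<phi>\<close> preserves the numbers of 1-cells and the topmost 1-cells of these rectangles.
\<close>

section \<open>Fillings as graphs of functions\<close>

text \<open>The cut at the column \<open>cc\<close> of \<open>CRC\<close> is dictated by the major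
  index. In the rows meeting column \<open>c\<close>, only right cells lie above \<open>CLC\<close>,
  and the leftmost of these is in column \<open>cc\<close>. So a rectangle of width
  \<open>w \<ge> c\<close> has a left topmost cell exactly as long as \<open>w < cc\<close>, and the
  sizes summed over these widths telescope to the length of column \<open>c\<close> minus that of
  column \<open>cc\<close>, which is the number of rows in \<open>R2\<close>.

  Two obstacles shape the induction. Deleting a row, be it the top row or an empty one, may change
  which rectangles are maximal; therefore the major index is carried along as a sum over all widths,
  and maximal rectangles appear only when this sum is identified with \<open>maj\<close>. Moreover,
  the algorithm must not disturb what rows added later depend on. Each swap involves a cell in a
  column at least \<open>c\<close>, which windows narrower than \<open>c\<close> do not see, while
  in wider windows that meet the new row its cell is the topmost one in any case.\<close>

definition graph_on :: "int set \<Rightarrow> (int \<Rightarrow> int) \<Rightarrow> cell set" where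
  "graph_on I f = (\<lambda>i. (i, f i)) ` I"

text \<open>A set instead of a single column, so that an empty filling needs no default value. With
  at most one 1-cell per row it has at most one element.\<close>

definition tops :: "cell set \<Rightarrow> int set" where
  "tops X = {j. \<exists>i. (i, j) \<in> X \<and> (\<forall>x\<in>X. i \<le> fst x)}"

lemma mem_graph_on [simp]: "(i, j) \<in> graph_on I f \<longleftrightarrow> i \<in> I \<and> j = f i"
  by (auto simp: graph_on_def)

lemma rows_graph_on [simp]: "rows (graph_on I f) = I"
  by (auto simp: rows_def graph_on_def image_image)

lemma one_col_graph_on [simp]: "i \<in> I \<Longrightarrow> one_col (graph_on I f) i = f i"
  by (simp add: one_col_def)

lemma mem_rows: "(i, j) \<in> P \<Longrightarrow> i \<in> rows P"
  by (force simp: rows_def)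

lemma rows_iff: "i \<in> rows P \<longleftrightarrow> (\<exists>j. (i, j) \<in> P)"
  by (force simp: rows_def)

lemma rows_Un: "rows (A \<union> B) = rows A \<union> rows B"
  by (auto simp: rows_def)

lemma swap_rows_graph_on:
  assumes "x \<in> I" "y \<in> I"
  shows "swap_rows (graph_on I f) x y = graph_on I (f \<circ> transpose x y)"
proof (intro set_eqI)
  fix z show "z \<in> swap_rows (graph_on I f) x y \<longleftrightarrow> z \<in> graph_on I (f \<circ> transpose x y)"
    using assms by (cases z; cases "fst z = x"; cases "fst z = y")
      (auto simp: swap_rows_def)
qed

text \<open>This decomposition lets a rotation of \<open>gamma1_loop\<close> be treated as two
  applications of the swap lemmas below.\<close>

lemma rotate_rows_graph_on:
  assumes "x \<in> I" "y \<in> I" "z \<in> I" "x \<noteq> y" "y \<noteq> z" "x \<noteq> z"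
  shows "rotate_rows (graph_on I f) x y z =
    graph_on I (f \<circ> transpose y z \<circ> transpose x y)"
proof (intro set_eqI)
  fix u show "u \<in> rotate_rows (graph_on I f) x y z \<longleftrightarrow>
      u \<in> graph_on I (f \<circ> transpose y z \<circ> transpose x y)"
    using assms by (cases u; cases "fst u = x"; cases "fst u = y"; cases "fst u = z")
      (auto simp: rotate_rows_def)
qed

lemma mem_tops_graph_on:
  "j \<in> tops (graph_on A h) \<longleftrightarrow> (\<exists>i\<in>A. h i = j \<and> (\<forall>k\<in>A. i \<le> k))"
  by (auto simp: tops_def graph_on_def)

lemma double_sum_remove2:
  fixes e :: "'a \<Rightarrow> 'a \<Rightarrow> nat"
  assumes "finite I" "x \<in> I" "y \<in> I" "x \<noteq> y"
  shows "(\<Sum>i\<in>I. \<Sum>k\<in>I. e i k) =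
    (\<Sum>i\<in>I - {x, y}. \<Sum>k\<in>I - {x, y}. e i k)
    + (\<Sum>k\<in>I - {x, y}. e x k + e k x + e y k + e k y)
    + (e x x + e x y + e y x + e y y)"
proof -
  have split: "sum h I = h x + h y + sum h (I - {x, y})" for h :: "'a \<Rightarrow> nat"
    using assms sum.remove[of I x h] sum.remove[of "I - {x}" y h]
    by (simp add: Diff_insert2[symmetric] insert_commute)
  show ?thesis
    by (simp add: split sum.distrib)
qed

lemma card_pairs_eq_sum:
  assumes "finite I"
  shows "card {(i, k). i \<in> I \<and> k \<in> I \<and> Q i k} = (\<Sum>i\<in>I. \<Sum>k\<in>I. of_bool (Q i k))"
proof -
  have "{(i, k). i \<in> I \<and> k \<in> I \<and> Q i k} = Sigma I (\<lambda>i. {k \<in> I. Q i k})"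
    by auto
  then show ?thesis
    using assms by (simp add: Int_def)
qed

lemma card_split_less:
  fixes f :: "'a \<Rightarrow> int"
  assumes "finite A"
  shows "card A = card {k \<in> A. f k < c} + card {k \<in> A. c \<le> f k}"
proof -
  have "card ({k \<in> A. f k < c} \<union> {k \<in> A. c \<le> f k}) = card {k \<in> A. f k < c} + card {k \<in> A. c \<le> f k}"
    using assms by (intro card_Un_disjoint) auto
  moreover have "{k \<in> A. f k < c} \<union> {k \<in> A. c \<le> f k} = A"
    by auto
  ultimately show ?thesis
    by simp
qed

lemma finite_graph_on: "finite I \<Longrightarrow> finite (graph_on I g)"
  by (simp add: graph_on_def)

lemma card_graph_on [simp]: "card (graph_on I f) = card I"
  unfolding graph_on_def by (rule card_image) (simp add: inj_on_def)

lemma card_permuted: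
  assumes "p permutes A" "finite A"
  shows "card {i \<in> A. Q (p i)} = card {i \<in> A. Q i}"
proof -
  have "p ` {i \<in> A. Q (p i)} = {i \<in> A. Q i}"
    using permutes_image[OF assms(1)] permutes_in_image[OF assms(1)]
    by (auto simp: image_iff)
  then show ?thesis
    using card_image[OF inj_on_subset[OF permutes_inj_on[OF assms(1), of UNIV]], of "{i \<in> A. Q (p i)}"]
    by simp
qed

section \<open>Swapping two 1-cells of a Ferrers diagram\<close>

text \<open>
  The rows of the diagram need not be consecutive, because \<open>\<gamma>\<^sub>r\<close> is applied after deleting rows
  without changing the indices of the others.
\<close>

locale ferrers_rows =
  fixes D :: "cell set" and a :: int
  assumes finite_diagram: "finite D"
    and left_bound: "(i, j) \<in> D \<Longrightarrow> a \<le> j"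
    and closed: "\<lbrakk>(i, j) \<in> D; i' \<in> rows D; i' \<le> i; a \<le> j'; j' \<le> j\<rbrakk> \<Longrightarrow> (i', j') \<in> D"
begin

definition valid :: "(int \<Rightarrow> int) \<Rightarrow> bool" where
  "valid f \<longleftrightarrow> (\<forall>i\<in>rows D. (i, f i) \<in> D)"

text \<open>The NE chains of the filling with column function \<open>f\<close>, given by their rows.\<close>

definition invs :: "(int \<Rightarrow> int) \<Rightarrow> (int \<times> int) set" where
  "invs f = {(i, k). i \<in> rows D \<and> k \<in> rows D \<and> (i < k \<and> f k < f i \<and> (k, f i) \<in> D)}"

text \<open>
  The second conjunct is what makes the induction work: the major index contributed by the next row
  added on top sees of a filling only the topmost 1-cells within initial segments of columns.
\<close>

definition left_equiv :: "int \<Rightarrow> int set \<Rightarrow> (int \<Rightarrow> int) \<Rightarrow> (int \<Rightarrow> int) \<Rightarrow> bool" where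
  "left_equiv c E f g \<longleftrightarrow> (\<exists>p. p permutes E \<and> g = f \<circ> p) \<and>
     (\<forall>J w. E \<subseteq> J \<longrightarrow> J \<subseteq> rows D \<longrightarrow> w < c \<longrightarrow>
        tops (graph_on {i \<in> J. f i \<le> w} f) = tops (graph_on {i \<in> J. g i \<le> w} g))"

lemma finite_rows: "finite (rows D)"
  using finite_diagram by (simp add: rows_def)

lemma column_subset_rows: "column_of D j \<subseteq> rows D"
  by (force simp: column_of_def rows_def)

lemma finite_column: "finite (column_of D j)"
  using finite_subset[OF column_subset_rows finite_rows] .

lemma column_mono: "a \<le> j \<Longrightarrow> j \<le> j' \<Longrightarrow> column_of D j' \<subseteq> column_of D j"
  unfolding column_of_def using closed[of _ j' _ j] mem_rows by blast

lemma column_down: "i \<in> column_of D j \<Longrightarrow> k \<in> rows D \<Longrightarrow> k \<le> i \<Longrightarrow> k \<in> column_of D j"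
  unfolding column_of_def using closed[of i j k j] left_bound[of i j] by blast

lemma left_equiv_refl: "left_equiv c E f f"
  unfolding left_equiv_def by (auto intro!: exI[of _ id] permutes_id)

lemma left_equiv_sym:
  assumes "left_equiv c E f g"
  shows "left_equiv c E g f"
proof -
  obtain p where p: "p permutes E" "g = f \<circ> p"
    using assms unfolding left_equiv_def by blast
  then have "f = g \<circ> inv p" "inv p permutes E"
    by (simp_all add: comp_assoc permutes_inv_o permutes_inv)
  then show ?thesis
    using assms unfolding left_equiv_def by auto
qed

lemma left_equiv_trans:
  assumes "left_equiv c E f g" "left_equiv c E g h"
  shows "left_equiv c E f h"
proof -
  obtain p q where "p permutes E" "g = f \<circ> p" "q permutes E" "h = g \<circ> q"
    using assms unfolding left_equiv_def by blast
  then have "p \<circ> q permutes E" "h = f \<circ> (p \<circ> q)"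
    by (simp_all add: comp_assoc permutes_compose)
  then show ?thesis
    using assms unfolding left_equiv_def by auto
qed

lemma left_equiv_mono:
  assumes "left_equiv c E f g" "E \<subseteq> E'"
  shows "left_equiv c E' f g"
proof -
  obtain p where "p permutes E" "g = f \<circ> p"
    using assms unfolding left_equiv_def by blast
  then have "\<exists>p. p permutes E' \<and> g = f \<circ> p"
    using permutes_subset assms(2) by blast
  then show ?thesis
    using assms unfolding left_equiv_def by auto
qed

text \<open>The chains that a third row forms with \<open>x\<close> and \<open>y\<close> are
  compared jointly, and their total does not change; only the pair \<open>x\<close>,
  \<open>y\<close> itself becomes a chain. For the second claim, a window with \<open>w < c\<close>
  sees neither the cell in column \<open>f y\<close> nor the cells in the rows between, so the other
  cell moves from row \<open>x\<close> to row \<open>y\<close> without passing a visible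
  cell.\<close>

lemma swap_creates_chain:
  assumes "valid f" and xy: "x \<in> rows D" "y \<in> rows D" "x < y" and less: "f x < f y"
    and above_between: "\<forall>k\<in>rows D. x < k \<and> k < y \<longrightarrow> f y < f k"
  defines "g \<equiv> f \<circ> transpose x y"
  shows "valid g" and "card (invs g) = card (invs f) + 1"
    and "c \<le> f y \<Longrightarrow> left_equiv c {x, y} f g"
proof -
  have between: "f y < f k" if "k \<in> rows D" "x < k" "k < y" for k
    using above_between that by blast
  have gx [simp]: "g x = f y" and gy [simp]: "g y = f x"
    by (simp_all add: g_def)
  have gk: "g k = f k" if "k \<noteq> x" "k \<noteq> y" for k
    using that by (simp add: g_def transpose_def)
  have fin: "finite (rows D)"
    by (rule finite_rows)
  have v: "(i, f i) \<in> D" if "i \<in> rows D" for i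
    using assms(1) that by (simp add: valid_def)
  have low: "a \<le> f i" if "i \<in> rows D" for i
    using v[OF that] left_bound by blast
  have yD: "(k, j) \<in> D" if "k \<in> rows D" "k \<le> y" "a \<le> j" "j \<le> f y" for k j
    using closed[OF v[OF xy(2)]] that by blast
  show "valid g"
    unfolding valid_def
  proof
    fix i assume "i \<in> rows D"
    then show "(i, g i) \<in> D"
      using yD[of x "f y"] yD[of y "f x"] xy less low v gk by (cases "i = x \<or> i = y") auto
  qed
  define e :: "(int \<Rightarrow> int) \<Rightarrow> int \<Rightarrow> int \<Rightarrow> nat"
    where "e h i k = of_bool (i < k \<and> h k < h i \<and> (k, h i) \<in> D)"
    for h i k
  have card_e: "card (invs h) = (\<Sum>i\<in>rows D. \<Sum>k\<in>rows D. e h i k)" for h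
    unfolding invs_def e_def by (rule card_pairs_eq_sum[OF fin])
  have same: "(\<Sum>i\<in>rows D - {x, y}. \<Sum>k\<in>rows D - {x, y}. e g i k) =
      (\<Sum>i\<in>rows D - {x, y}. \<Sum>k\<in>rows D - {x, y}. e f i k)"
    by (intro sum.cong refl) (auto simp: e_def gk)
  have cross: "e g x k + e g k x + e g y k + e g k y = e f x k + e f k x + e f y k + e f k y"
    if k: "k \<in> rows D" "k \<noteq> x" "k \<noteq> y" for k
  proof -
    consider "k < x" | "x < k" "k < y" | "y < k"
      using k xy by linarith
    then show ?thesis
    proof cases
      case 1
      \<comment> \<open>If \<open>f k \<le> f y\<close>, both corners exist and only the comparison
        of columns counts, which is symmetric in the two cells. Otherwise both cells are to the left
        of \<open>f k\<close> and only the corners count, which do not depend on the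
        filling.\<close>
      have "(x, f k) \<in> D" "(y, f k) \<in> D" if "f k \<le> f y"
        using that yD[of _ "f k"] low[OF k(1)] xy by auto
      then show ?thesis
        using 1 xy less gk[OF k(2,3)] by (auto simp: e_def of_bool_def)
    next
      case 2
      then show ?thesis
        using between[OF k(1) 2] less gk[OF k(2,3)] by (auto simp: e_def of_bool_def)
    next
      case 3
      then show ?thesis
        using xy gk[OF k(2,3)] by (auto simp: e_def of_bool_def)
    qed
  qed
  have pair: "e g x x + e g x y + e g y x + e g y y = 1" "e f x x + e f x y + e f y x + e f y y = 0"
    using xy less v[OF xy(2)] by (auto simp: e_def)
  have "(\<Sum>k\<in>rows D - {x, y}. e g x k + e g k x + e g y k + e g k y) =
      (\<Sum>k\<in>rows D - {x, y}. e f x k + e f k x + e f y k + e f k y)"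
    by (intro sum.cong refl cross) auto
  then show "card (invs g) = card (invs f) + 1"
    using xy same pair
    by (simp add: card_e double_sum_remove2[OF fin xy(1,2), of "e g"]
        double_sum_remove2[OF fin xy(1,2), of "e f"])
  assume c: "c \<le> f y"
  have "tops (graph_on {i \<in> J. f i \<le> w} f) = tops (graph_on {i \<in> J. g i \<le> w} g)"
    if J: "{x, y} \<subseteq> J" "J \<subseteq> rows D" "w < c" for J w
  proof (cases "f x \<le> w")
    case False
    then have "graph_on {i \<in> J. f i \<le> w} f = graph_on {i \<in> J. g i \<le> w} g"
      using c J gk by (auto simp: graph_on_def g_def transpose_def image_iff)
    then show ?thesis
      by simp
  next
    case True
    define K where "K = {i \<in> J - {x, y}. f i \<le> w}"
    have Kf: "{i \<in> J. f i \<le> w} = insert x K"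
      using c J True by (auto simp: K_def)
    have "i \<in> J \<and> g i \<le> w \<longleftrightarrow> i \<in> insert y K" for i
      using c J True gk[of i] by (cases "i = x \<or> i = y") (auto simp: K_def)
    then have Kg: "{i \<in> J. g i \<le> w} = insert y K"
      by blast
    have out: "k < x \<or> y < k" if "k \<in> K" for k
      using that between[of k] c J by (force simp: K_def)
    have fg: "g k = f k" if "k \<in> K" for k
      using that gk by (auto simp: K_def)
    have "j \<in> tops (graph_on (insert x K) f) \<longleftrightarrow> j \<in> tops (graph_on (insert y K) g)" for j
    proof
      assume "j \<in> tops (graph_on (insert x K) f)"
      then obtain i where i: "i \<in> insert x K" "f i = j" "\<And>k. k \<in> insert x K \<Longrightarrow> i \<le> k"
        unfolding mem_tops_graph_on by blast
      have "\<exists>i\<in>insert y K. g i = j \<and> (\<forall>k\<in>insert y K. i \<le> k)"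
      proof (cases "i = x")
        case True
        have "y \<le> k" if "k \<in> K" for k
          using i(3)[of k] out[OF that] that True by auto
        then show ?thesis
          using True i(2) by auto
      next
        case False
        then show ?thesis
          using i fg xy(3) by (intro bexI[of _ i]) force+
      qed
      then show "j \<in> tops (graph_on (insert y K) g)"
        unfolding mem_tops_graph_on .
    next
      assume "j \<in> tops (graph_on (insert y K) g)"
      then obtain i where i: "i \<in> insert y K" "g i = j" "\<And>k. k \<in> insert y K \<Longrightarrow> i \<le> k"
        unfolding mem_tops_graph_on by blast
      have "\<exists>i\<in>insert x K. f i = j \<and> (\<forall>k\<in>insert x K. i \<le> k)"
      proof (cases "i = y")
        case True
        then show ?thesis
          using i xy(3) by (intro bexI[of _ x]) force+
      next
        case False
        then have "i \<in> K" "i < x"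
          using i(1) i(3)[of y] out[of i] by auto
        then show ?thesis
          using i fg by (intro bexI[of _ i]) force+
      qed
      then show "j \<in> tops (graph_on (insert x K) f)"
        unfolding mem_tops_graph_on .
    qed
    then show ?thesis
      unfolding Kf Kg by blast
  qed
  moreover have "transpose x y permutes {x, y}"
    by (simp add: permutes_swap_id)
  ultimately show "left_equiv c {x, y} f g"
    unfolding left_equiv_def g_def by blast
qed

text \<open>The inverse of the preceding swap. Row \<open>y\<close> receives a cell further to the
  right than its own, so \<open>corner\<close> is what keeps the new filling inside the
  diagram.\<close>

lemma swap_removes_chain:
  assumes "valid g" and xy: "x \<in> rows D" "y \<in> rows D" "x < y" and less: "g y < g x"
    and corner: "(y, g x) \<in> D"
    and above_between: "\<forall>k\<in>rows D. x < k \<and> k < y \<longrightarrow> g x < g k"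
  defines "f \<equiv> g \<circ> transpose x y"
  shows "valid f" and "card (invs g) = card (invs f) + 1"
    and "c \<le> g x \<Longrightarrow> left_equiv c {x, y} g f"
proof -
  have g: "g = f \<circ> transpose x y"
    by (simp add: f_def comp_assoc)
  have fk: "f k = g k" if "k \<noteq> x" "k \<noteq> y" for k
    using that by (simp add: f_def transpose_def)
  have "(x, g y) \<in> D"
    using assms(1) xy closed[of y "g y" x "g y"] left_bound[of y "g y"] by (auto simp: valid_def)
  then show v: "valid f"
    using assms(1) corner by (auto simp: valid_def f_def transpose_def)
  have less': "f x < f y" and "f y = g x"
    using less by (simp_all add: f_def)
  have between': "\<forall>k\<in>rows D. x < k \<and> k < y \<longrightarrow> f y < f k"
    using above_between fk \<open>f y = g x\<close> by auto
  show "card (invs g) = card (invs f) + 1"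
    using swap_creates_chain(2)[OF v xy less' between'] unfolding g[symmetric] by blast
  show "c \<le> g x \<Longrightarrow> left_equiv c {x, y} g f"
    using swap_creates_chain(3)[OF v xy less' between', of c] unfolding g[symmetric] \<open>f y = g x\<close>
    by (blast intro: left_equiv_sym)
qed

end

section \<open>The effect of the algorithm on NE chains\<close>

context ferrers_rows
begin

lemma one_col_graph_on_column [simp]:
  "i \<in> column_of D j \<Longrightarrow> one_col (graph_on (rows D) f) i = f i"
  using column_subset_rows by (intro one_col_graph_on) blast

lemma column_total: "a \<le> i \<Longrightarrow> a \<le> j \<Longrightarrow> column_of D i \<subseteq> column_of D j \<or> column_of D j \<subseteq> column_of D i"
  using column_mono by (meson linorder_le_cases)

lemma col_length_eq_iff:
  assumes "a \<le> i" "a \<le> j"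
  shows "col_length D i = col_length D j \<longleftrightarrow> column_of D i = column_of D j"
  unfolding col_length_def using column_total[OF assms] finite_column card_subset_eq by metis

lemma col_length_less_iff:
  assumes "a \<le> i" "a \<le> j"
  shows "col_length D i < col_length D j \<longleftrightarrow> column_of D i \<subset> column_of D j"
proof
  assume "col_length D i < col_length D j"
  then have "\<not> column_of D j \<subseteq> column_of D i"
    unfolding col_length_def using card_mono[OF finite_column] by (meson leD)
  then show "column_of D i \<subset> column_of D j"
    using column_total[OF assms] by blast
next
  assume "column_of D i \<subset> column_of D j"
  then show "col_length D i < col_length D j"
    unfolding col_length_def by (rule psubset_card_mono[OF finite_column])
qed

lemma column_psubset_imp_less:
  assumes "a \<le> j" "column_of D j \<subset> column_of D i"
  shows "i < j"
  using column_mono[OF assms(1), of i] assms(2) by (meson leI leD psubsetE)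

lemma valid_low: "valid f \<Longrightarrow> i \<in> rows D \<Longrightarrow> a \<le> f i"
  unfolding valid_def using left_bound by blast

lemma valid_mem_column: "valid f \<Longrightarrow> i \<in> rows D \<Longrightarrow> i \<in> column_of D (f i)"
  by (simp add: valid_def column_of_def)

text \<open>
  Throughout the loop the cell of the first pointer lies in a column of exactly the rows \<open>E\<close>. A left
  cell in the list costs one NE chain; a rotation is a swap removing a chain followed by a swap
  creating one. The premises \<open>above\<close> and \<open>below\<close> are the loop invariants that supply the left
  cell for a rotation and ensure that only cells in shorter columns lie between the swapped cells.
\<close>

lemma gamma1_loop_graph:
  fixes c :: int and E :: "int set"
  assumes "valid f" "p1 \<in> E" "column_of D (f p1) = E" "c \<le> f p1"
    and "sorted_wrt (<) (p1 # ps)" "set ps \<subseteq> E" "E \<subseteq> column_of D c"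
    and skip: "\<And>k. k \<in> E \<Longrightarrow> p1 < k \<Longrightarrow> k \<notin> set ps \<Longrightarrow> c \<le> f k \<and> column_of D (f k) \<subset> E"
    and above: "\<And>k. k \<in> rows D \<Longrightarrow> k < p1 \<Longrightarrow> c \<le> f k \<Longrightarrow> E \<subset> column_of D (f k) \<Longrightarrow>
      \<exists>l\<in>rows D. k < l \<and> l < p1 \<and> f l < c"
    and below: "\<And>k. k \<in> set ps \<Longrightarrow> c \<le> f k \<Longrightarrow> E \<subset> column_of D (f k) \<Longrightarrow>
      \<exists>l\<in>rows D. l < k \<and> f l < c"
  shows "\<exists>g. gamma1_loop D c p1 ps (graph_on (rows D) f) = graph_on (rows D) g \<and> valid g \<and>
    left_equiv c E f g \<and> card (invs f) = card (invs g) + card {k \<in> set ps. f k < c} \<and>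
    (\<forall>k\<in>E. c \<le> g k \<longrightarrow> E \<subset> column_of D (g k) \<longrightarrow> (\<exists>l\<in>E. k < l \<and> g l < c))"
  using assms
proof (induction ps arbitrary: p1 f)
  case Nil
  have down: "l \<in> E" if "l \<in> rows D" "l < p1" for l
    using column_down[of p1 "f p1" l] Nil(2,3) that by auto
  \<comment> \<open>By \<open>skip\<close>, a right cell of \<open>E\<close> in a longer column must
    be above \<open>p1\<close>. There \<open>above\<close> supplies the left cell, which belongs to
    \<open>E\<close> because columns are closed upwards.\<close>
  have "\<exists>l\<in>E. k < l \<and> f l < c" if k: "k \<in> E" "c \<le> f k" "E \<subset> column_of D (f k)" for k
  proof -
    have "k \<noteq> p1" "\<not> p1 < k"
      using Nil(3) Nil(8)[of k] k by auto
    moreover have "k \<in> rows D"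
      using k Nil(3) column_subset_rows by blast
    ultimately show ?thesis
      using Nil(9)[of k] k down by fastforce
  qed
  then show ?case
    using Nil(1) left_equiv_refl by (intro exI[of _ f]) simp
next
  case (Cons p2 ps)
  note prems = Cons.prems
  have E: "E \<subseteq> rows D"
    using prems(3) column_subset_rows by blast
  have p: "p1 \<in> rows D" "p2 \<in> rows D" "p1 < p2" "p2 \<in> E" "sorted_wrt (<) (p2 # ps)"
    "sorted_wrt (<) (p1 # ps)" "set ps \<subseteq> E" "p2 \<notin> set ps"
    using prems E by auto
  have below_p2: "p2 < k" if "k \<in> set ps" for k
    using prems(5) that by auto
  have low: "a \<le> f i" if "i \<in> rows D" for i
    using valid_low[OF prems(1) that] .
  have down: "k \<in> E" if "k \<in> rows D" "k \<le> p2" for k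
    using column_down[of p2 "f p1" k] prems(3) p(4) that by auto
  have between_skip: "c \<le> f k \<and> column_of D (f k) \<subset> E" if "k \<in> rows D" "p1 < k" "k < p2" for k
    using prems(8)[of k] down[of k] below_p2[of k] that by force
  \<comment> \<open>The rows jumped over hold cells in columns shorter than \<open>E\<close>, hence
    strictly to the right of \<open>f p1\<close>.\<close>
  have between: "\<forall>k\<in>rows D. p1 < k \<and> k < p2 \<longrightarrow> f p1 < f k"
    using column_psubset_imp_less[OF low, of _ "f p1"] between_skip prems(3) by blast
  have corner: "(p2, f p1) \<in> D"
    using p(4) prems(3) by (auto simp: column_of_def)
  have one_col [simp]: "one_col (graph_on (rows D) f) p1 = f p1" "one_col (graph_on (rows D) f) p2 = f p2"
    using p by simp_all
  show ?case
  proof (cases "f p2 < c")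
    case True
    define g where "g = f \<circ> transpose p1 p2"
    have less: "f p2 < f p1"
      using True prems(4) by simp
    note low3 = swap_removes_chain[OF prems(1) p(1,2,3) less corner between, folded g_def]
    have gk: "g k = f k" if "k \<noteq> p1" "k \<noteq> p2" for k
      using that by (simp add: g_def transpose_def)
    have g12: "g p1 = f p2" "g p2 = f p1"
      by (simp_all add: g_def)
    have gps: "g k = f k" if "k \<in> set ps" for k
      using gk below_p2[OF that] p(3) by auto
    \<comment> \<open>The swap leaves a left cell in row \<open>p1\<close>, just behind the new
      pointer; it is the witness for both \<open>above\<close> and \<open>below\<close>.\<close>
    have "\<exists>g'. gamma1_loop D c p2 ps (graph_on (rows D) g) = graph_on (rows D) g' \<and> valid g' \<and>
        left_equiv c E g g' \<and> card (invs g) = card (invs g') + card {k \<in> set ps. g k < c} \<and>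
        (\<forall>k\<in>E. c \<le> g' k \<longrightarrow> E \<subset> column_of D (g' k) \<longrightarrow> (\<exists>l\<in>E. k < l \<and> g' l < c))"
    proof (rule Cons.IH)
      show "c \<le> g k \<and> column_of D (g k) \<subset> E" if "k \<in> E" "p2 < k" "k \<notin> set ps" for k
        using prems(8)[of k] gk[of k] that p(3) by auto
      show "\<exists>l\<in>rows D. k < l \<and> l < p2 \<and> g l < c"
        if k: "k \<in> rows D" "k < p2" "c \<le> g k" "E \<subset> column_of D (g k)" for k
      proof -
        have "k \<noteq> p1"
          using g12 True k by auto
        then have fk: "g k = f k"
          using gk k by auto
        then have "k < p1"
          using between_skip[of k] k \<open>k \<noteq> p1\<close> by (cases "p1 < k") auto
        then show ?thesis
          using p(1,3) g12 True by (intro bexI[of _ p1]) auto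
      qed
      show "\<exists>l\<in>rows D. l < k \<and> g l < c" if "k \<in> set ps" for k
        using below_p2[OF that] p(1,3) g12 True by (intro bexI[of _ p1]) auto
    qed (use low3 p prems g12 in auto)
    then obtain g' where g': "gamma1_loop D c p2 ps (graph_on (rows D) g) = graph_on (rows D) g'"
        "valid g'" "left_equiv c E g g'" "card (invs g) = card (invs g') + card {k \<in> set ps. g k < c}"
        "\<forall>k\<in>E. c \<le> g' k \<longrightarrow> E \<subset> column_of D (g' k) \<longrightarrow> (\<exists>l\<in>E. k < l \<and> g' l < c)"
      by blast
    have "left_equiv c E f g"
      using left_equiv_mono[OF low3(3)[OF prems(4)]] prems(2) p(4) by simp
    then have le: "left_equiv c E f g'"
      using left_equiv_trans g'(3) by blast
    have "{k \<in> set (p2 # ps). f k < c} = insert p2 {k \<in> set ps. g k < c}"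
      using True gps by auto
    then have "card {k \<in> set (p2 # ps). f k < c} = Suc (card {k \<in> set ps. g k < c})"
      using p(8) by simp
    then have "card (invs f) = card (invs g') + card {k \<in> set (p2 # ps). f k < c}"
      using low3(2) g'(4) by simp
    moreover have "gamma1_loop D c p1 (p2 # ps) (graph_on (rows D) f) = graph_on (rows D) g'"
      using True g'(1) p(1,2) by (simp add: swap_rows_graph_on g_def)
    ultimately show ?thesis
      using g' le by blast
  next
    case right: False
    then have card_ps: "{k \<in> set (p2 # ps). f k < c} = {k \<in> set ps. f k < c}"
      by auto
    consider (same) "column_of D (f p2) = E" | (shorter) "column_of D (f p2) \<subset> E"
      | (longer) "E \<subset> column_of D (f p2)"
      using column_total[OF low[OF p(1)] low[OF p(2)]] prems(3) by blast
    then show ?thesis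
    proof cases
      case same
      have "\<exists>g. gamma1_loop D c p2 ps (graph_on (rows D) f) = graph_on (rows D) g \<and> valid g \<and>
        left_equiv c E f g \<and> card (invs f) = card (invs g) + card {k \<in> set ps. f k < c} \<and>
        (\<forall>k\<in>E. c \<le> g k \<longrightarrow> E \<subset> column_of D (g k) \<longrightarrow> (\<exists>l\<in>E. k < l \<and> g l < c))"
      proof (rule Cons.IH)
        show "c \<le> f k \<and> column_of D (f k) \<subset> E" if "k \<in> E" "p2 < k" "k \<notin> set ps" for k
          using prems(8)[of k] that p(3) by auto
        show "\<exists>l\<in>rows D. k < l \<and> l < p2 \<and> f l < c"
          if k: "k \<in> rows D" "k < p2" "c \<le> f k" "E \<subset> column_of D (f k)" for k
        proof -
          have "k < p1"
            using between_skip[of k] k prems(3) by (cases "p1 < k"; cases "k = p1") auto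
          then show ?thesis
            using prems(9)[of k] k p(3) by force
        qed
        show "\<exists>l\<in>rows D. l < k \<and> f l < c" if "k \<in> set ps" "c \<le> f k" "E \<subset> column_of D (f k)" for k
          using prems(10)[of k] that by auto
      qed (use prems p same right in auto)
      moreover have "col_length D (f p1) = col_length D (f p2)"
        using same prems(3) by (simp add: col_length_def)
      ultimately show ?thesis
        using right card_ps by simp
    next
      case shorter
      have "\<exists>g. gamma1_loop D c p1 ps (graph_on (rows D) f) = graph_on (rows D) g \<and> valid g \<and>
        left_equiv c E f g \<and> card (invs f) = card (invs g) + card {k \<in> set ps. f k < c} \<and>
        (\<forall>k\<in>E. c \<le> g k \<longrightarrow> E \<subset> column_of D (g k) \<longrightarrow> (\<exists>l\<in>E. k < l \<and> g l < c))"
      proof (rule Cons.IH)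
        show "c \<le> f k \<and> column_of D (f k) \<subset> E" if "k \<in> E" "p1 < k" "k \<notin> set ps" for k
          using prems(8)[of k] that shorter right by (cases "k = p2") auto
        show "\<exists>l\<in>rows D. k < l \<and> l < p1 \<and> f l < c"
          if k: "k \<in> rows D" "k < p1" "c \<le> f k" "E \<subset> column_of D (f k)" for k
          using prems(9)[of k] k by blast
        show "\<exists>l\<in>rows D. l < k \<and> f l < c" if "k \<in> set ps" "c \<le> f k" "E \<subset> column_of D (f k)" for k
          using prems(10)[of k] that by auto
      qed (use prems p in auto)
      moreover have "col_length D (f p1) \<noteq> col_length D (f p2)"
          "\<not> col_length D (f p1) < col_length D (f p2)"
        using shorter prems(3) low p by (auto simp: col_length_eq_iff col_length_less_iff)
      ultimately show ?thesis
        using right card_ps by simp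
    next
      case longer
      have less: "f p2 < f p1"
        using column_psubset_imp_less[OF low[OF p(1)], of "f p2"] longer prems(3) by simp
      define L where "L = {l \<in> column_of D c. l < p1 \<and> f l < c}"
      define i where "i = Max L"
      have finL: "finite L"
        using finite_column by (simp add: L_def)
      \<comment> \<open>The left cell given by \<open>below\<close> cannot be in row
        \<open>p1\<close> or between the pointers, where all cells are right. So it is above
        \<open>p1\<close>, and the maximum defining \<open>i\<close> is taken over a nonempty
        set.\<close>
      obtain l where l: "l \<in> rows D" "l < p2" "f l < c"
        using prems(10)[of p2] right longer by auto
      have "l < p1"
        using between_skip[of l] l prems(4) by (metis leD linorder_neqE)
      then have "l \<in> L"
        using l down[of l] prems(7) p(3) by (auto simp: L_def)
      then have iL: "i \<in> L"
        unfolding i_def using Max_in[OF finL] by blast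
      then have i: "i \<in> rows D" "i < p1" "f i < c" "i \<in> E"
        using down[of i] p(3) column_subset_rows by (auto simp: L_def)
      have i_max: "k \<le> i" if "k \<in> L" for k
        unfolding i_def using Max_ge[OF finL that] .
      have Lmem: "k \<in> L" if "k \<in> rows D" "k < p1" "f k < c" for k
        using that down[of k] prems(7) p(3) by (auto simp: L_def)
      have lowest: "lowest_left_above D c (graph_on (rows D) f) p1 = i"
      proof -
        have "{l \<in> column_of D c. l < p1 \<and> one_col (graph_on (rows D) f) l < c} = L"
          unfolding L_def by auto
        then show ?thesis
          by (simp add: lowest_left_above_def i_def)
      qed
      \<comment> \<open>A cell between \<open>i\<close> and \<open>p1\<close> is right and not in a
        column longer than \<open>E\<close>, for otherwise \<open>above\<close> would give a left
        cell below the lowest one. As the column of \<open>f p2\<close> is longer than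
        \<open>E\<close>, the cell is to the right of \<open>f p2\<close>.\<close>
      have between': "f p2 < f k" if k: "k \<in> rows D" "i < k" "k < p1" for k
      proof -
        have "c \<le> f k"
          using Lmem[of k] i_max[of k] k by force
        then have "\<not> E \<subset> column_of D (f k)"
          using prems(9)[of k] k Lmem i_max by force
        then have "column_of D (f k) \<subseteq> E"
          using column_total[OF low[OF p(1)] low[OF k(1)]] prems(3) by blast
        then show ?thesis
          using column_psubset_imp_less[OF low[OF k(1)], of "f p2"] longer by blast
      qed
      define h where "h = f \<circ> transpose p1 p2"
      define g where "g = h \<circ> transpose i p1"
      note low3 = swap_removes_chain[OF prems(1) p(1,2,3) less corner between, folded h_def]
      have hk: "h k = f k" if "k \<noteq> p1" "k \<noteq> p2" for k
        using that by (simp add: h_def transpose_def)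
      have h12: "h p1 = f p2" "h p2 = f p1" "h i = f i"
        using i(2) p(3) hk[of i] by (simp_all add: h_def)
      have less2: "h i < h p1"
        using h12 i(3) right by simp
      have between2: "\<forall>k\<in>rows D. i < k \<and> k < p1 \<longrightarrow> h p1 < h k"
        using between' hk h12 p(3) by auto
      note up3 = swap_creates_chain[OF low3(1) i(1) p(1) i(2) less2 between2, folded g_def]
      have g12: "g p1 = f i" "g p2 = f p1" "g i = f p2"
        using h12 i(2) p(3) by (simp_all add: g_def transpose_def)
      have gk: "g k = f k" if "k \<noteq> p1" "k \<noteq> p2" "k \<noteq> i" for k
        using that hk[of k] by (simp add: g_def transpose_def)
      have gps: "g k = f k" if "k \<in> set ps" for k
        using gk below_p2[OF that] p(3) i(2) by auto
      have "\<exists>g'. gamma1_loop D c p2 ps (graph_on (rows D) g) = graph_on (rows D) g' \<and> valid g' \<and>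
          left_equiv c E g g' \<and> card (invs g) = card (invs g') + card {k \<in> set ps. g k < c} \<and>
          (\<forall>k\<in>E. c \<le> g' k \<longrightarrow> E \<subset> column_of D (g' k) \<longrightarrow> (\<exists>l\<in>E. k < l \<and> g' l < c))"
      proof (rule Cons.IH)
        show "c \<le> g k \<and> column_of D (g k) \<subset> E" if "k \<in> E" "p2 < k" "k \<notin> set ps" for k
          using prems(8)[of k] gk[of k] that p(3) i(2) by auto
        show "\<exists>l\<in>rows D. k < l \<and> l < p2 \<and> g l < c"
          if k: "k \<in> rows D" "k < p2" "c \<le> g k" "E \<subset> column_of D (g k)" for k
        proof -
          have "k \<noteq> p1"
            using g12 i(3) k by auto
          moreover have "\<not> p1 < k"
            using between_skip[of k] gk[of k] k i(2) by auto
          ultimately show ?thesis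
            using p(1,3) g12 i(3) by (intro bexI[of _ p1]) auto
        qed
        show "\<exists>l\<in>rows D. l < k \<and> g l < c" if "k \<in> set ps" for k
          using below_p2[OF that] p(1,3) g12 i(3) by (intro bexI[of _ p1]) auto
      qed (use up3(1) p prems g12 in auto)
      then obtain g' where g': "gamma1_loop D c p2 ps (graph_on (rows D) g) = graph_on (rows D) g'"
          "valid g'" "left_equiv c E g g'" "card (invs g) = card (invs g') + card {k \<in> set ps. g k < c}"
          "\<forall>k\<in>E. c \<le> g' k \<longrightarrow> E \<subset> column_of D (g' k) \<longrightarrow> (\<exists>l\<in>E. k < l \<and> g' l < c)"
        by blast
      have "left_equiv c E f h"
        using left_equiv_mono[OF low3(3)[OF prems(4)]] prems(2) p(4) by simp
      moreover have "left_equiv c E h g"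
        using left_equiv_mono[OF up3(3)] right h12 prems(2) i(4) by simp
      ultimately have le: "left_equiv c E f g'"
        using left_equiv_trans g'(3) by blast
      have "{k \<in> set ps. f k < c} = {k \<in> set ps. g k < c}"
        using gps by auto
      then have inv_count: "card (invs f) = card (invs g') + card {k \<in> set (p2 # ps). f k < c}"
        using low3(2) up3(2) g'(4) card_ps by simp
      moreover have "rotate_rows (graph_on (rows D) f) i p1 p2 = graph_on (rows D) g"
        using i(1,2) p(1,2,3) by (subst rotate_rows_graph_on) (auto simp: g_def h_def)
      moreover have "col_length D (f p1) < col_length D (f p2)"
        using longer prems(3) low p by (simp add: col_length_less_iff)
      ultimately have "gamma1_loop D c p1 (p2 # ps) (graph_on (rows D) f) = graph_on (rows D) g'"
        using right less lowest g'(1) by simp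
      then show ?thesis
        using g' le inv_count by blast
    qed
  qed
qed

text \<open>The two pointers are on adjacent rows of the diagram, because every row above one that
  meets column \<open>c\<close> also meets it; so no cell lies between the swapped ones. The row of
  the first pointer always holds a left cell, hence every right cell encountered yields one new
  chain.\<close>

lemma gamma2_loop_graph:
  assumes "valid f" "p1 \<in> column_of D c" "f p1 < c" "sorted_wrt (<) (p1 # ps)"
    "set ps \<subseteq> column_of D c"
    and "\<forall>k\<in>column_of D c. p1 < k \<longrightarrow> k \<in> set ps"
  shows "\<exists>g. gamma2_loop c p1 ps (graph_on (rows D) f) = graph_on (rows D) g \<and> valid g \<and>
    left_equiv c (column_of D c) f g \<and> card (invs g) = card (invs f) + card {k \<in> set ps. c \<le> f k}"
  using assms
proof (induction ps arbitrary: p1 f)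
  case Nil
  then show ?case
    using left_equiv_refl by (intro exI[of _ f]) simp
next
  case (Cons p2 ps)
  note prems = Cons.prems
  have p: "p1 \<in> rows D" "p2 \<in> rows D" "p1 < p2" "p2 \<in> column_of D c" "sorted_wrt (<) (p2 # ps)"
    "set ps \<subseteq> column_of D c" "p2 \<notin> set ps"
    using prems column_subset_rows by auto
  have below_p2: "p2 < k" if "k \<in> set ps" for k
    using prems(4) that by auto
  have consecutive: "\<forall>k\<in>rows D. p1 < k \<and> k < p2 \<longrightarrow> f p2 < f k"
    using prems(6) column_down[OF p(4)] below_p2 by fastforce
  have rest: "\<forall>k\<in>column_of D c. p2 < k \<longrightarrow> k \<in> set ps"
    using prems(6) p(3) by auto
  show ?case
  proof (cases "c \<le> f p2")
    case False
    then have "{k \<in> set (p2 # ps). c \<le> f k} = {k \<in> set ps. c \<le> f k}"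
      by auto
    then show ?thesis
      using Cons.IH[OF prems(1) p(4) _ p(5,6) rest] False p(2) by simp
  next
    case True
    define g where "g = f \<circ> transpose p1 p2"
    have "f p1 < f p2"
      using True prems(3) by simp
    note up3 = swap_creates_chain[OF prems(1) p(1,2,3) this consecutive, folded g_def]
    have g2: "g p2 = f p1"
      by (simp add: g_def)
    have gps: "g k = f k" if "k \<in> set ps" for k
      using below_p2[OF that] p(3) by (simp add: g_def transpose_def)
    obtain g' where g': "gamma2_loop c p2 ps (graph_on (rows D) g) = graph_on (rows D) g'"
        "valid g'" "left_equiv c (column_of D c) g g'"
        "card (invs g') = card (invs g) + card {k \<in> set ps. c \<le> g k}"
      using Cons.IH[OF up3(1) p(4) _ p(5,6) rest] g2 prems(3) by auto
    have "left_equiv c (column_of D c) f g"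
      using left_equiv_mono[OF up3(3)[OF True]] prems(2) p(4) by simp
    then have "left_equiv c (column_of D c) f g'"
      using left_equiv_trans g'(3) by blast
    moreover have "{k \<in> set (p2 # ps). c \<le> f k} = insert p2 {k \<in> set ps. c \<le> g k}"
      using True gps by auto
    then have "card {k \<in> set (p2 # ps). c \<le> f k} = Suc (card {k \<in> set ps. c \<le> g k})"
      using p(7) by simp
    then have "card (invs g') = card (invs f) + card {k \<in> set (p2 # ps). c \<le> f k}"
      using up3(2) g'(4) by simp
    ultimately show ?thesis
      using g' True p(1,2) by (auto simp: swap_rows_graph_on g_def)
  qed
qed

definition lefts :: "int \<Rightarrow> (int \<Rightarrow> int) \<Rightarrow> int set" where
  "lefts c f = {i \<in> column_of D c. f i < c}"

text \<open>Without left cells \<open>Min\<close> is unspecified; the value matters only where a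
  left cell exists.\<close>

definition rights :: "int \<Rightarrow> (int \<Rightarrow> int) \<Rightarrow> int set" where
  "rights c f = {i \<in> column_of D c. i < Min (lefts c f) \<and> c \<le> f i}"

text \<open>
  By \<open>sum_top_weight_eq_gain\<close> below, the gain is also the growth of the major index when a row with
  1-cell in column \<open>c\<close> is put on top.
\<close>

definition gain :: "int \<Rightarrow> (int \<Rightarrow> int) \<Rightarrow> nat" where
  "gain c f = (if lefts c f = {} then 0 else if rights c f = {} then card (column_of D c)
     else card (column_of D c - column_of D (Min (f ` rights c f))))"

text \<open>\<open>borrow\<close> states what the borrowing swap requires in order to create exactly
  one chain: a left cell above \<open>p\<close>, and only cells to the right of \<open>f p\<close>
  between it and \<open>p\<close>. The borrowed swap then accounts for the right cell in the highest
  row just as the loop accounts for the others.\<close>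

lemma gamma2_graph:
  assumes "valid f" "R2 \<subseteq> column_of D c"
    and lower_part: "\<And>i k. i \<in> R2 \<Longrightarrow> k \<in> column_of D c \<Longrightarrow> i < k \<Longrightarrow> k \<in> R2"
    and borrow: "\<And>p. p \<in> R2 \<Longrightarrow> (\<forall>k\<in>R2. p \<le> k) \<Longrightarrow> c \<le> f p \<Longrightarrow>
      (\<exists>l\<in>column_of D c. l < p \<and> f l < c) \<and>
      (\<forall>k\<in>rows D. k < p \<longrightarrow> (\<forall>l\<in>rows D. k \<le> l \<longrightarrow> l < p \<longrightarrow> c \<le> f l) \<longrightarrow> f p < f k)"
  shows "\<exists>g. gamma2 D c R2 (graph_on (rows D) f) = graph_on (rows D) g \<and> valid g \<and>
    left_equiv c (column_of D c) f g \<and> card (invs g) = card (invs f) + card {k \<in> R2. c \<le> f k}"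
proof (cases "sorted_list_of_set R2")
  case Nil
  have "finite R2"
    using assms(2) finite_column finite_subset by blast
  then have "R2 = {}"
    using Nil by simp
  then show ?thesis
    using assms(1) left_equiv_refl by (intro exI[of _ f]) (simp add: gamma2_def)
next
  case (Cons p ps)
  have fin: "finite R2"
    using assms(2) finite_column finite_subset by blast
  have sorted: "sorted_wrt (<) (p # ps)" and R2: "set (p # ps) = R2"
    using strict_sorted_list_of_set[of R2] set_sorted_list_of_set[OF fin] Cons by auto
  have p: "p \<in> R2" "p \<in> column_of D c" "p \<notin> set ps" "p \<in> rows D" "\<forall>k\<in>R2. p \<le> k"
    using R2 assms(2) sorted column_subset_rows by (auto simp: less_imp_le)
  have ps: "set ps \<subseteq> column_of D c" "\<forall>k\<in>column_of D c. p < k \<longrightarrow> k \<in> set ps"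
    using R2 assms(2) lower_part[OF p(1)] by auto
  show ?thesis
  proof (cases "c \<le> f p")
    case False
    then have "{k \<in> R2. c \<le> f k} = {k \<in> set ps. c \<le> f k}"
      using R2 by auto
    then show ?thesis
      using gamma2_loop_graph[OF assms(1) p(2) _ sorted ps] False p Cons
      by (simp add: gamma2_def)
  next
    case True
    define L where "L = {l \<in> column_of D c. l < p \<and> f l < c}"
    define i where "i = Max L"
    have finL: "finite L"
      using finite_column by (simp add: L_def)
    have "L \<noteq> {}"
      using borrow[OF p(1,5) True] by (auto simp: L_def)
    then have "i \<in> L"
      unfolding i_def using Max_in[OF finL] by blast
    then have i: "i \<in> column_of D c" "i < p" "f i < c" "i \<in> rows D"
      using column_subset_rows by (auto simp: L_def)
    have i_max: "k \<le> i" if "k \<in> L" for k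
      unfolding i_def using Max_ge[OF finL that] .
    have Lmem: "k \<in> L" if "k \<in> rows D" "k < p" "f k < c" for k
      using that column_down[OF p(2)] by (auto simp: L_def)
    have lowest: "lowest_left_above D c (graph_on (rows D) f) p = i"
    proof -
      have "{l \<in> column_of D c. l < p \<and> one_col (graph_on (rows D) f) l < c} = L"
        unfolding L_def by auto
      then show ?thesis
        by (simp add: lowest_left_above_def i_def)
    qed
    have between: "\<forall>k\<in>rows D. i < k \<and> k < p \<longrightarrow> f p < f k"
    proof (intro ballI impI)
      fix k assume k: "k \<in> rows D" "i < k \<and> k < p"
      have "\<forall>l\<in>rows D. k \<le> l \<longrightarrow> l < p \<longrightarrow> c \<le> f l"
        using Lmem i_max k(2) by force
      then show "f p < f k"
        using borrow[OF p(1,5) True] k by blast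
    qed
    define h where "h = f \<circ> transpose i p"
    have less: "f i < f p"
      using i(3) True by simp
    note up3 = swap_creates_chain[OF assms(1) i(4) p(4) i(2) less between, folded h_def]
    have hp: "h p = f i"
      by (simp add: h_def)
    have hps: "h k = f k" if "k \<in> set ps" for k
    proof -
      have "p < k"
        using that sorted by simp
      then show ?thesis
        using i(2) by (simp add: h_def transpose_def)
    qed
    obtain g where g: "gamma2_loop c p ps (graph_on (rows D) h) = graph_on (rows D) g" "valid g"
        "left_equiv c (column_of D c) h g" "card (invs g) = card (invs h) + card {k \<in> set ps. c \<le> h k}"
      using gamma2_loop_graph[OF up3(1) p(2) _ sorted ps] hp i(3) by auto
    have "left_equiv c (column_of D c) f h"
      using left_equiv_mono[OF up3(3)[OF True]] i(1) p(2) by simp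
    then have le: "left_equiv c (column_of D c) f g"
      using left_equiv_trans g(3) by blast
    have "{k \<in> R2. c \<le> f k} = insert p {k \<in> set ps. c \<le> h k}"
      using R2 hps True by auto
    then have "card {k \<in> R2. c \<le> f k} = Suc (card {k \<in> set ps. c \<le> h k})"
      using p(3) by simp
    then have "card (invs g) = card (invs f) + card {k \<in> R2. c \<le> f k}"
      using g(4) up3(2) by simp
    moreover have "gamma2 D c R2 (graph_on (rows D) f) = graph_on (rows D) g"
      using Cons True p(4) i(4) g(1) lowest by (simp add: gamma2_def swap_rows_graph_on h_def)
    ultimately show ?thesis
      using g(2) le by blast
  qed
qed

text \<open>The left cells of \<open>R1\<close> and the right cells of \<open>R2\<close> change the
  chain count by minus one and plus one each. Every left cell is in \<open>R1\<close> or
  \<open>R2\<close>, so adding \<open>card (lefts c f)\<close> leaves one unit for each row of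
  \<open>R2\<close>. The equation is additive because natural subtraction would truncate.\<close>

lemma gamma_graph:
  assumes v: "valid f" and "a \<le> c"
  shows "\<exists>g. gamma D c (graph_on (rows D) f) = graph_on (rows D) g \<and> valid g \<and>
    left_equiv c (column_of D c) f g \<and> card (invs g) + card (lefts c f) = card (invs f) + gain c f"
proof -
  define R where "R = column_of D c"
  define clc where "clc = Min (lefts c f)"
  define cc where "cc = Min (f ` rights c f)"
  define crc where "crc = Max {i \<in> rights c f. f i = cc}"
  define R1 where "R1 = (if lefts c f = {} \<or> rights c f = {} then {} else {i \<in> column_of D cc. crc \<le> i})"
  define R2 where "R2 = (if lefts c f = {} then {}
               else if rights c f = {} then {i \<in> R. clc \<le> i}
               else R - column_of D cc)"
  have lefts: "{i \<in> R. one_col (graph_on (rows D) f) i < c} = lefts c f"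
    by (auto simp: lefts_def R_def)
  have rights: "{i \<in> R. i < clc \<and> c \<le> one_col (graph_on (rows D) f) i} = rights c f"
    by (auto simp: rights_def R_def clc_def)
  have image: "one_col (graph_on (rows D) f) ` rights c f = f ` rights c f"
    by (intro image_cong refl) (auto simp: rights_def)
  have crc': "{i \<in> rights c f. one_col (graph_on (rows D) f) i = cc} = {i \<in> rights c f. f i = cc}"
    by (intro Collect_cong) (auto simp: rights_def)
  have gamma: "gamma D c (graph_on (rows D) f) = gamma2 D c R2 (gamma1 D c R1 (graph_on (rows D) f))"
    unfolding gamma_def Let_def
    by (simp only: R_def[symmetric] lefts clc_def[symmetric] rights image cc_def[symmetric] crc'
        crc_def[symmetric] R1_def[symmetric] R2_def[symmetric])
  have finR: "finite R" "finite (lefts c f)" "finite (rights c f)"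
    by (auto simp: R_def lefts_def rights_def finite_column)
  have low: "a \<le> f i" if "i \<in> rows D" for i
    using valid_low[OF v that] .
  have R_rows: "R \<subseteq> rows D"
    by (simp add: R_def column_subset_rows)
  show ?thesis
  proof (cases "lefts c f = {}")
    case True
    then have "gamma D c (graph_on (rows D) f) = graph_on (rows D) f"
      by (simp add: gamma R1_def R2_def gamma1_def gamma2_def)
    then show ?thesis
      using True v left_equiv_refl by (intro exI[of _ f]) (simp add: gain_def)
  next
    case left: False
    have "clc \<in> lefts c f"
      unfolding clc_def by (rule Min_in[OF finR(2) left])
    then have clc: "clc \<in> R" "f clc < c" "clc \<in> rows D"
      using R_rows by (auto simp: lefts_def R_def)
    have clc_min: "clc \<le> i" if "i \<in> rows D" "i \<in> R" "f i < c" for i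
      unfolding clc_def using that by (intro Min_le[OF finR(2)]) (simp add: lefts_def R_def)
    show ?thesis
    proof (cases "rights c f = {}")
      case True
      \<comment> \<open>With no right cell above it, \<open>CLC\<close> is in the highest row of
        \<open>R\<close>. Hence \<open>R2\<close> is all of \<open>R\<close> and no borrowing takes
        place.\<close>
      have "clc \<le> i" if "i \<in> R" for i
        using True that clc_min[of i] R_rows by (force simp: rights_def R_def clc_def)
      then have R2: "R2 = R" and "\<forall>p. (\<forall>k\<in>R. p \<le> k) \<longrightarrow> p \<in> R \<longrightarrow> p = clc"
        using left True clc(1) by (auto simp: R2_def intro: order_antisym)
      then have "\<exists>g. gamma2 D c R2 (graph_on (rows D) f) = graph_on (rows D) g \<and> valid g \<and>
          left_equiv c (column_of D c) f g \<and> card (invs g) = card (invs f) + card {k \<in> R2. c \<le> f k}"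
        using clc(2) by (intro gamma2_graph[OF v]) (auto simp: R_def)
      moreover have "card R = card (lefts c f) + card {k \<in> R2. c \<le> f k}"
        using card_split_less[OF finR(1), of f c] by (simp add: R2 lefts_def R_def)
      moreover have "gamma1 D c R1 (graph_on (rows D) f) = graph_on (rows D) f"
        using True by (simp add: R1_def gamma1_def)
      ultimately show ?thesis
        using left True by (auto simp: gamma gain_def R_def)
    next
      case right: False
      define E where "E = column_of D cc"
      have "cc \<in> f ` rights c f"
        unfolding cc_def using finR right by (intro Min_in) auto
      then have "{i \<in> rights c f. f i = cc} \<noteq> {}"
        by auto
      then have "crc \<in> {i \<in> rights c f. f i = cc}"
        unfolding crc_def using finR by (intro Max_in) auto
      then have crc: "crc \<in> R" "crc < clc" "c \<le> cc" "f crc = cc" "crc \<in> rows D"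
        using R_rows by (auto simp: rights_def R_def clc_def)
      have crc_max: "i \<le> crc" if "i \<in> rights c f" "f i = cc" for i
        unfolding crc_def using that finR by (intro Max_ge) auto
      have cc_min: "cc \<le> f i" if "i \<in> R" "i < clc" for i
      proof -
        have "i \<in> rights c f"
          using clc_min[of i] R_rows that by (force simp: rights_def R_def clc_def)
        then show ?thesis
          unfolding cc_def using finR by (intro Min_le) auto
      qed
      have E_R: "E \<subseteq> R" and E_down: "\<And>i k. i \<in> E \<Longrightarrow> k \<in> rows D \<Longrightarrow> k \<le> i \<Longrightarrow> k \<in> E"
        unfolding E_def R_def using column_mono[OF \<open>a \<le> c\<close> crc(3)] column_down by auto
      \<comment> \<open>No cell of \<open>R\<close> above \<open>CLC\<close> is in a column longer
        than \<open>E\<close>, since \<open>CRC\<close> is the leftmost of them. Both premises of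
        \<open>gamma1_loop_graph\<close> about longer columns follow from this.\<close>
      have E_above: "column_of D (f i) \<subseteq> E" if "i \<in> R" "i < clc" for i
        unfolding E_def using column_mono[OF _ cc_min[OF that]] \<open>a \<le> c\<close> crc(3) by simp
      have "crc \<in> E"
        using valid_mem_column[OF v crc(5)] crc(4) by (simp add: E_def)
      have R1: "R1 = {i \<in> E. crc \<le> i}" and R2: "R2 = R - E"
        using left right by (auto simp: R1_def R2_def E_def)
      have finE: "finite E"
        by (simp add: E_def finite_column)
      have "Min R1 = crc" "R1 \<noteq> {}" "finite R1"
        using \<open>crc \<in> E\<close> finE by (auto simp: R1 intro!: Min_eqI)
      then obtain ps where ps: "sorted_list_of_set R1 = crc # ps"
        using sorted_list_of_set_nonempty by metis
      have sorted: "sorted_wrt (<) (crc # ps)" and "set (crc # ps) = R1"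
        using strict_sorted_list_of_set[of R1] set_sorted_list_of_set[OF \<open>finite R1\<close>] ps by auto
      then have set_ps: "set ps = {i \<in> E. crc < i}"
        using \<open>crc \<in> E\<close> by (fastforce simp: R1)
      have "\<exists>g. gamma1_loop D c crc ps (graph_on (rows D) f) = graph_on (rows D) g \<and> valid g \<and>
        left_equiv c E f g \<and> card (invs f) = card (invs g) + card {k \<in> set ps. f k < c} \<and>
        (\<forall>k\<in>E. c \<le> g k \<longrightarrow> E \<subset> column_of D (g k) \<longrightarrow> (\<exists>l\<in>E. k < l \<and> g l < c))"
      proof (rule gamma1_loop_graph[OF v \<open>crc \<in> E\<close> _ _ sorted])
        show "\<exists>l\<in>rows D. k < l \<and> l < crc \<and> f l < c"
          if k: "k \<in> rows D" "k < crc" "E \<subset> column_of D (f k)" for k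
        proof -
          have "k \<in> R"
            using E_down[OF \<open>crc \<in> E\<close> k(1)] k(2) E_R by auto
          then show ?thesis
            using E_above[of k] crc(2) k by auto
        qed
        show "\<exists>l\<in>rows D. l < k \<and> f l < c" if k: "k \<in> set ps" "c \<le> f k" "E \<subset> column_of D (f k)" for k
        proof -
          have "\<not> k < clc"
            using E_above[of k] E_R k set_ps by auto
          moreover have "k \<noteq> clc"
            using clc(2) k(2) by auto
          ultimately show ?thesis
            using clc by (intro bexI[of _ clc]) auto
        qed
      qed (use set_ps E_R crc in \<open>auto simp: E_def R_def\<close>)
      then obtain g1 where g1: "gamma1_loop D c crc ps (graph_on (rows D) f) = graph_on (rows D) g1"
          "valid g1" "left_equiv c E f g1" "card (invs f) = card (invs g1) + card {k \<in> set ps. f k < c}"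
          "\<forall>k\<in>E. c \<le> g1 k \<longrightarrow> E \<subset> column_of D (g1 k) \<longrightarrow> (\<exists>l\<in>E. k < l \<and> g1 l < c)"
        by blast
      obtain q where q: "q permutes E" "g1 = f \<circ> q"
        using g1(3) by (auto simp: left_equiv_def)
      have g1_out: "g1 k = f k" if "k \<notin> E" for k
        using permutes_not_in[OF q(1) that] by (simp add: q(2))
      have "\<exists>g. gamma2 D c R2 (graph_on (rows D) g1) = graph_on (rows D) g \<and> valid g \<and>
          left_equiv c (column_of D c) g1 g \<and> card (invs g) = card (invs g1) + card {k \<in> R2. c \<le> g1 k}"
      proof (rule gamma2_graph[OF g1(2)])
        show "R2 \<subseteq> column_of D c"
          by (auto simp: R2 R_def)
        show "k \<in> R2" if "i \<in> R2" "k \<in> column_of D c" "i < k" for i k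
          using that E_down[of k i] R_rows by (auto simp: R2 R_def)
      next
        fix p assume p: "p \<in> R2" "\<forall>k\<in>R2. p \<le> k" "c \<le> g1 p"
        have p': "p \<in> R" "p \<notin> E" "p \<in> rows D" "g1 p = f p"
          using p(1) R_rows g1_out by (auto simp: R2)
        have p_col: "p \<in> column_of D (g1 p)"
          using valid_mem_column[OF g1(2) p'(3)] .
        \<comment> \<open>If borrowing happens, the highest row \<open>p\<close> of
          \<open>R2\<close> is below \<open>CLC\<close>, so \<open>CLC\<close> was in a row of
          \<open>E\<close>. Since \<open>q\<close> only permutes \<open>E\<close>, some row of
          \<open>E\<close>, and thus above \<open>p\<close>, still holds a left cell.\<close>
        have "\<not> p < clc"
          using E_above[of p] p' p_col by auto
        then have "clc < p"
          using p(3) p'(4) clc(2) by (cases "p = clc") auto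
        then have "clc \<in> E"
          using p(2) clc(1) by (force simp: R2)
        then have inv_E: "inv q clc \<in> E" and "g1 (inv q clc) < c"
          using permutes_in_image[OF permutes_inv[OF q(1)]] permutes_inverses(1)[OF q(1)] clc(2)
          by (auto simp: q(2))
        have E_p: "l < p" if "l \<in> E" for l
          using E_down[OF that p'(3)] p'(2) by force
        have "f p < g1 k" if k: "k \<in> rows D" "k < p" "\<forall>l\<in>rows D. k \<le> l \<longrightarrow> l < p \<longrightarrow> c \<le> g1 l" for k
        proof -
          have "k \<in> R"
            using column_down[of p c k] p'(1) k by (simp add: R_def)
          then have "k \<in> E"
            using p(2) k(2) by (force simp: R2)
          \<comment> \<open>This is the purpose of the last conclusion of
            \<open>gamma1_loop_graph\<close>: a right cell in a column longer than \<open>E\<close>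
            would have a left cell below it in \<open>E\<close>, hence above
            \<open>p\<close>.\<close>
          have "\<not> E \<subset> column_of D (g1 k)"
          proof
            assume "E \<subset> column_of D (g1 k)"
            then obtain l where l: "l \<in> E" "k < l" "g1 l < c"
              using g1(5) \<open>k \<in> E\<close> k by blast
            then show False
              using k(3) E_p[of l] E_R R_rows by fastforce
          qed
          then have "column_of D (g1 k) \<subseteq> E"
            using column_total[of cc "g1 k"] valid_low[OF g1(2) k(1)] \<open>a \<le> c\<close> crc(3)
            by (auto simp: E_def)
          then have "\<not> column_of D (g1 p) \<subseteq> column_of D (g1 k)"
            using p_col p'(2) by blast
          then show ?thesis
            using column_mono[of "g1 k" "g1 p"] valid_low[OF g1(2) k(1)] p'(4) by force
        qed
        then show "(\<exists>l\<in>column_of D c. l < p \<and> g1 l < c) \<and>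
          (\<forall>k\<in>rows D. k < p \<longrightarrow> (\<forall>l\<in>rows D. k \<le> l \<longrightarrow> l < p \<longrightarrow> c \<le> g1 l) \<longrightarrow> g1 p < g1 k)"
          using inv_E E_p \<open>g1 (inv q clc) < c\<close> E_R p'(4) by (auto simp: R_def)
      qed
      then obtain g where g: "gamma2 D c R2 (graph_on (rows D) g1) = graph_on (rows D) g" "valid g"
          "left_equiv c R g1 g" "card (invs g) = card (invs g1) + card {k \<in> R2. c \<le> g1 k}"
        by (auto simp: R_def)
      have "left_equiv c R f g1"
        using left_equiv_mono[OF g1(3) E_R] .
      then have "left_equiv c R f g"
        using left_equiv_trans g(3) by blast
      moreover have "gamma D c (graph_on (rows D) f) = graph_on (rows D) g"
        using g1(1) g(1) ps by (simp add: gamma gamma1_def)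
      moreover have "card (invs g) + card (lefts c f) = card (invs f) + gain c f"
      proof -
        have R2_right: "{k \<in> R2. c \<le> g1 k} = {k \<in> R2. c \<le> f k}"
          using g1_out by (auto simp: R2)
        have "lefts c f = {k \<in> set ps. f k < c} \<union> {k \<in> R2. f k < c}"
          using clc_min crc(2) E_R R_rows by (force simp: lefts_def set_ps R2 R_def)
        moreover have "{k \<in> set ps. f k < c} \<inter> {k \<in> R2. f k < c} = {}"
          by (auto simp: set_ps R2)
        ultimately have l: "card (lefts c f) = card {k \<in> set ps. f k < c} + card {k \<in> R2. f k < c}"
          using finR by (simp add: card_Un_disjoint R2)
        have "card R2 = card {k \<in> R2. f k < c} + card {k \<in> R2. c \<le> f k}"
          using finR by (intro card_split_less) (simp add: R2)
        moreover have "gain c f = card R2"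
          using left right by (simp add: gain_def R2 R_def E_def cc_def)
        ultimately show ?thesis
          using l g(4) g1(4) R2_right by simp
      qed
      ultimately show ?thesis
        using g(2) by (auto simp: R_def)
    qed
  qed
qed

end

section \<open>Adding a top row to the major index\<close>

definition one_per_row :: "cell set \<Rightarrow> bool" where
  "one_per_row X \<longleftrightarrow> (\<forall>i j j'. (i, j) \<in> X \<longrightarrow> (i, j') \<in> X \<longrightarrow> j = j')"

definition descents :: "cell set \<Rightarrow> (cell \<times> cell) set" where
  "descents X = {(x, y). x \<in> X \<and> y \<in> X \<and> fst x < fst y \<and> snd y < snd x \<and>
     (\<forall>z\<in>X. \<not> (fst x < fst z \<and> fst z < fst y))}"

text \<open>
  A descent contributes to \<open>maj_rect\<close> once for each nonempty row weakly below it; the third cell of a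
  triple marks this row.
\<close>

definition maj_triples :: "cell set \<Rightarrow> (cell \<times> cell \<times> cell) set" where
  "maj_triples X = {(x, y, z). (x, y) \<in> descents X \<and> z \<in> X \<and> fst y \<le> fst z}"

definition top_weight :: "int \<Rightarrow> cell set \<Rightarrow> nat" where
  "top_weight c X = (if \<exists>j\<in>tops X. j < c then card X else 0)"

lemma one_per_row_subset: "one_per_row X \<Longrightarrow> Y \<subseteq> X \<Longrightarrow> one_per_row Y"
  unfolding one_per_row_def by blast

lemma top_weight_empty [simp]: "top_weight c {} = 0"
  by (simp add: top_weight_def)

lemma maj_triples_empty [simp]: "maj_triples {} = {}"
  by (auto simp: maj_triples_def)

lemma finite_maj_triples: "finite X \<Longrightarrow> finite (maj_triples X)"
  by (rule finite_subset[of _ "X \<times> X \<times> X"]) (auto simp: maj_triples_def descents_def)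

text \<open>The new cell can form a descent only with the topmost cell of \<open>X\<close>, so
  \<open>Y\<close> has at most one element. Such a descent lies weakly above every cell of
  \<open>X\<close> and is counted once for each. The new cell is above all of \<open>X\<close> and
  so marks no row below a descent.\<close>

lemma card_maj_triples_insert:
  assumes fin: "finite X" and one: "one_per_row X" and above: "\<forall>x\<in>X. r < fst x"
  shows "card (maj_triples (insert (r, c) X)) = card (maj_triples X) + top_weight c X"
proof -
  define Y where "Y = {y \<in> X. snd y < c \<and> (\<forall>x\<in>X. fst y \<le> fst x)}"
  have notin: "(r, c) \<notin> X"
    using above by auto
  have desc: "(x, y) \<in> descents (insert (r, c) X) \<longleftrightarrow> (x, y) \<in> descents X \<or> x = (r, c) \<and> y \<in> Y" for x y
  proof (cases "x = (r, c)")
    case True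
    have "(\<forall>z\<in>X. \<not> (r < fst z \<and> fst z < fst y)) \<longleftrightarrow> (\<forall>z\<in>X. fst y \<le> fst z)"
      using above by (auto simp: not_less)
    then have "((r, c), y) \<in> descents (insert (r, c) X) \<longleftrightarrow> y \<in> Y"
      unfolding descents_def Y_def using above by (cases "y = (r, c)") force+
    then show ?thesis
      unfolding True using notin by (simp add: descents_def)
  next
    case False
    then have "x \<in> insert (r, c) X \<Longrightarrow> r < fst x"
      using above by blast
    then show ?thesis
      using False unfolding descents_def by (cases "y = (r, c)") auto
  qed
  have in_X: "x \<in> X" "y \<in> X" if "(x, y) \<in> descents X" for x y
    using that by (auto simp: descents_def)
  have Y_X: "Y \<subseteq> X"
    by (auto simp: Y_def)
  have r_less: "r < fst y" if "y \<in> X" for y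
    using above that by blast
  have below_Y: "fst y \<le> fst z" if "y \<in> Y" "z \<in> X" for y z
    using that by (simp add: Y_def)
  have "u \<in> maj_triples (insert (r, c) X) \<longleftrightarrow> u \<in> maj_triples X \<union> {(r, c)} \<times> Y \<times> X" for u
  proof -
    obtain x y z where u: "u = (x, y, z)"
      by (metis prod_cases3)
    have "y \<in> X \<Longrightarrow> z = (r, c) \<Longrightarrow> \<not> fst y \<le> fst z"
      using r_less[of y] by simp
    then show ?thesis
      unfolding u maj_triples_def using desc[of x y] in_X[of x y] Y_X below_Y[of y z] by auto
  qed
  then have "maj_triples (insert (r, c) X) = maj_triples X \<union> {(r, c)} \<times> Y \<times> X"
    by blast
  moreover have "maj_triples X \<inter> ({(r, c)} \<times> Y \<times> X) = {}"
    using notin in_X by (auto simp: maj_triples_def)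
  moreover have "finite Y"
    using fin by (simp add: Y_def)
  ultimately have "card (maj_triples (insert (r, c) X)) = card (maj_triples X) + card Y * card X"
    using fin by (simp add: card_Un_disjoint finite_maj_triples card_cartesian_product)
  moreover have "card Y * card X = top_weight c X"
  proof (cases "\<exists>j\<in>tops X. j < c")
    case True
    then obtain i j where ij: "(i, j) \<in> X" "\<forall>x\<in>X. i \<le> fst x" "j < c"
      by (auto simp: tops_def)
    have "y = (i, j)" if "y \<in> Y" for y
    proof -
      have "fst y = i"
        using that ij by (force simp: Y_def intro: order_antisym)
      then show ?thesis
        using that ij one by (cases y) (auto simp: Y_def one_per_row_def)
    qed
    moreover have "(i, j) \<in> Y"
      using ij by (simp add: Y_def)
    ultimately have "Y = {(i, j)}"
      by blast
    then show ?thesis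
      using True by (simp add: top_weight_def)
  next
    case False
    then have "Y = {}"
      by (force simp: Y_def tops_def)
    then show ?thesis
      using False by (simp add: top_weight_def)
  qed
  ultimately show ?thesis
    by simp
qed

lemma sum_telescope_int:
  fixes h :: "int \<Rightarrow> int"
  assumes "c \<le> m"
  shows "(\<Sum>w=c..m. h w - h (w + 1)) = h c - h (m + 1)"
  using assms
proof (induction m rule: int_ge_induct)
  case base
  then show ?case by simp
next
  case (step m)
  then have "{c..m + 1} = insert (m + 1) {c..m}"
    by auto
  then show ?case
    using step by simp
qed

context ferrers_rows
begin

text \<open>Row extent and width are separate parameters: \<open>v = w\<close> gives the rectangle
  of width \<open>w\<close>, and \<open>v = w + 1\<close> its overlap with the next wider
  one.\<close>

definition window_graph :: "(int \<Rightarrow> int) \<Rightarrow> int \<Rightarrow> int \<Rightarrow> cell set" where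
  "window_graph f v w = graph_on {i \<in> column_of D v. f i \<le> w} f"

text \<open>A row whose 1-cell is beyond column \<open>w\<close> also meets column
  \<open>w + 1\<close>. So the cells hidden from the two windows are in the same rows and cancel,
  and the difference does not depend on the filling.\<close>

lemma card_window_graph_diff:
  assumes "valid f" "a \<le> w"
  shows "int (card (window_graph f w w)) - int (card (window_graph f (w + 1) w)) =
    int (card (column_of D w)) - int (card (column_of D (w + 1)))"
proof -
  have split: "card (column_of D v) = card (window_graph f v w) + card {i \<in> column_of D v. w + 1 \<le> f i}" for v
    using card_split_less[OF finite_column, of v f "w + 1"] by (simp add: window_graph_def zless_add1_eq le_less)
  have "i \<in> column_of D (w + 1)" if "i \<in> column_of D w" "w + 1 \<le> f i" for i
    using valid_mem_column[OF assms(1), of i] column_subset_rows column_mono[of "w + 1" "f i"] assms(2) that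
    by auto
  then have "{i \<in> column_of D w. w + 1 \<le> f i} = {i \<in> column_of D (w + 1). w + 1 \<le> f i}"
    using column_mono[of w "w + 1"] assms(2) by auto
  then show ?thesis
    using split[of w] split[of "w + 1"] by simp
qed

text \<open>Cells above \<open>CLC\<close> are right and become visible once \<open>w\<close>
  reaches their column. Until then the topmost visible cell is \<open>CLC\<close>, or column
  \<open>v\<close> ends above \<open>CLC\<close>, the window is empty and both sides are 0. From
  then on a right cell precedes every left one.\<close>

lemma top_weight_window_graph:
  assumes "a \<le> c" "c \<le> v" "c \<le> w"
  shows "top_weight c (window_graph f v w) =
    (if lefts c f \<noteq> {} \<and> (rights c f = {} \<or> w < Min (f ` rights c f))
     then card (window_graph f v w) else 0)"
proof (cases "lefts c f = {}")
  case True
  have "\<not> j < c" if "j \<in> tops (window_graph f v w)" for j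
    using True that column_mono[OF assms(1,2)] by (auto simp: window_graph_def mem_tops_graph_on lefts_def)
  then show ?thesis
    using True by (auto simp: top_weight_def)
next
  case False
  define clc where "clc = Min (lefts c f)"
  have fin: "finite (lefts c f)" "finite (rights c f)"
    by (auto simp: lefts_def rights_def finite_column)
  have "clc \<in> lefts c f"
    unfolding clc_def by (rule Min_in[OF fin(1) False])
  then have clc: "clc \<in> column_of D c" "f clc < c"
    by (auto simp: lefts_def)
  have clc_min: "clc \<le> i" if "i \<in> column_of D c" "f i < c" for i
    unfolding clc_def using that by (intro Min_le[OF fin(1)]) (simp add: lefts_def)
  have col: "column_of D v \<subseteq> column_of D c"
    using column_mono[OF assms(1,2)] .
  show ?thesis
  proof (cases "rights c f = {} \<or> w < Min (f ` rights c f)")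
    case True
    have no: "clc \<le> i" if "i \<in> column_of D v" "f i \<le> w" for i
    proof (rule ccontr)
      assume i: "\<not> clc \<le> i"
      then have right: "i \<in> rights c f"
        using clc_min[of i] col that by (force simp: rights_def clc_def)
      then have "Min (f ` rights c f) \<le> f i"
        using fin by simp
      then show False
        using True that(2) right by auto
    qed
    show ?thesis
    proof (cases "clc \<in> column_of D v")
      case True
      then have "f clc \<in> tops (window_graph f v w)"
        using clc(2) assms(3) no by (auto simp: window_graph_def mem_tops_graph_on)
      then have "top_weight c (window_graph f v w) = card (window_graph f v w)"
        using clc(2) by (auto simp: top_weight_def)
      then show ?thesis
        using False \<open>rights c f = {} \<or> w < Min (f ` rights c f)\<close> by simp
    next
      case out: False
      have "clc \<in> column_of D v" if "i \<in> column_of D v" "f i \<le> w" for i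
        using column_down[OF that(1)] no[OF that] clc(1) column_subset_rows by blast
      then have "{i \<in> column_of D v. f i \<le> w} = {}"
        using out by blast
      then have "window_graph f v w = {}"
        unfolding window_graph_def by (simp add: graph_on_def)
      then show ?thesis
        by simp
    qed
  next
    case crc: False
    have "Min (f ` rights c f) \<in> f ` rights c f"
      using crc fin by (intro Min_in) auto
    then obtain k where k: "k \<in> rights c f" "f k \<le> w"
      using crc by (metis image_iff leI)
    then have "k \<in> rows D" "k < clc"
      using column_subset_rows by (auto simp: rights_def clc_def)
    have "\<not> j < c" if j: "j \<in> tops (window_graph f v w)" for j
    proof
      assume "j < c"
      obtain i where i: "i \<in> column_of D v" "f i = j" "\<forall>m\<in>{i \<in> column_of D v. f i \<le> w}. i \<le> m"
        using j unfolding window_graph_def mem_tops_graph_on by blast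
      have "k < i"
        using clc_min[of i] \<open>k < clc\<close> col i \<open>j < c\<close> by force
      then have "k \<in> column_of D v"
        using column_down[OF i(1) \<open>k \<in> rows D\<close>] by simp
      then show False
        using i(3) k(2) \<open>k < i\<close> by force
    qed
    then have "top_weight c (window_graph f v w) = 0"
      by (auto simp: top_weight_def)
    then show ?thesis
      using crc by simp
  qed
qed

text \<open>Only the widths below the column of \<open>CRC\<close> contribute. If left cells but no
  \<open>CRC\<close> exist, all widths up to \<open>b\<close> do, and the empty column
  \<open>b + 1\<close> ends the telescope.\<close>

lemma sum_top_weight_eq_gain:
  assumes v: "valid f" and "a \<le> c" "c \<le> b" and empty: "column_of D (b + 1) = {}"
  shows "(\<Sum>w=c..b. int (top_weight c (window_graph f w w)) -
    int (top_weight c (window_graph f (w + 1) w))) = int (gain c f)"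
proof -
  define h where "h w = int (card (column_of D w))" for w
  define Q where "Q w \<longleftrightarrow> lefts c f \<noteq> {} \<and> (rights c f = {} \<or> w < Min (f ` rights c f))" for w
  have "(\<Sum>w=c..b. int (top_weight c (window_graph f w w)) - int (top_weight c (window_graph f (w + 1) w)))
      = (\<Sum>w=c..b. if Q w then h w - h (w + 1) else 0)"
    using assms card_window_graph_diff[OF v]
    by (intro sum.cong refl) (auto simp: top_weight_window_graph Q_def h_def)
  also have "\<dots> = sum (\<lambda>w. h w - h (w + 1)) {w \<in> {c..b}. Q w}"
    by (rule sum.inter_filter[symmetric]) simp
  also have "\<dots> = int (gain c f)"
  proof (cases "lefts c f = {} \<or> rights c f = {}")
    case True
    then have "{w \<in> {c..b}. Q w} = (if lefts c f = {} then {} else {c..b})"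
      by (auto simp: Q_def)
    then show ?thesis
      using sum_telescope_int[OF \<open>c \<le> b\<close>, of h] empty True by (auto simp: gain_def h_def)
  next
    case False
    define cc where "cc = Min (f ` rights c f)"
    have fin: "finite (rights c f)"
      by (auto simp: rights_def finite_column)
    have "cc \<in> f ` rights c f"
      unfolding cc_def using False fin by (intro Min_in) auto
    then obtain k where k: "k \<in> rows D" "f k = cc" "c \<le> cc"
      using column_subset_rows by (auto simp: rights_def)
    have "\<not> b + 1 \<le> cc"
      using column_mono[of "b + 1" cc] valid_mem_column[OF v k(1)] k assms(2,3) empty by auto
    then have "{w \<in> {c..b}. Q w} = {c..cc - 1}"
      using False by (auto simp: Q_def cc_def[symmetric])
    moreover have "(\<Sum>w=c..cc - 1. h w - h (w + 1)) = h c - h cc"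
      using sum_telescope_int[of c "cc - 1" h] k(3) by (cases "c = cc") auto
    moreover have "column_of D cc \<subseteq> column_of D c"
      using column_mono[OF \<open>a \<le> c\<close> k(3)] .
    then have "h c - h cc = int (card (column_of D c - column_of D cc))"
      by (simp add: h_def card_Diff_subset finite_column card_mono of_nat_diff)
    ultimately show ?thesis
      using False by (simp add: gain_def cc_def)
  qed
  finally show ?thesis .
qed

end

section \<open>One step of the recursion\<close>

definition window :: "cell set \<Rightarrow> int \<Rightarrow> int \<Rightarrow> cell set" where
  "window P v w = column_of P v \<times> {..w}"

text \<open>
  Here the maximal rectangles are replaced by one rectangle for each width \<open>w\<close>. This is the major
  index because the intersection of consecutive maximal rectangles with right ends \<open>w < w'\<close> has
  the same cells of \<open>P\<close> as \<open>window P (w + 1) w\<close>, and the summand vanishes if \<open>w\<close> is not the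
  right end of a maximal rectangle.
\<close>

definition stack_maj :: "int \<Rightarrow> int \<Rightarrow> cell set \<Rightarrow> cell set \<Rightarrow> int" where
  "stack_maj a b P S = (\<Sum>w=a..b. int (card (maj_triples (S \<inter> window P w w)))
     - int (card (maj_triples (S \<inter> window P (w + 1) w))))"

text \<open>Of the rectangle spanned by a chain, only the lower right corner is tested; in a
  left-aligned stack the rest follows, see \<open>ne_eq_card_ne_chains\<close>.\<close>

definition ne_chains :: "cell set \<Rightarrow> cell set \<Rightarrow> (cell \<times> cell) set" where
  "ne_chains P S = {(x, y). x \<in> S \<and> y \<in> S \<and> fst x < fst y \<and> snd y < snd x \<and> (fst y, snd x) \<in> P}"

text \<open>The counts are taken over the whole filling for each width; \<open>card_window\<close>
  converts them to counts in a window. The topmost cells are compared only in columns through the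
  top row: a column of the next row added above either passes through the present top row or is
  empty here, see \<open>empty_window\<close>.\<close>

definition phi_spec :: "int \<Rightarrow> int \<Rightarrow> cell set \<Rightarrow> cell set \<Rightarrow> cell set \<Rightarrow> bool" where
  "phi_spec a b P S T \<longleftrightarrow> T \<subseteq> P \<and> one_per_row T \<and> rows T = rows P \<and>
     (\<forall>w. card {x \<in> T. snd x \<le> w} = card {x \<in> S. snd x \<le> w}) \<and>
     (\<forall>v w. w \<le> v \<longrightarrow> v \<le> w + 1 \<longrightarrow> (Min (rows P), v) \<in> P \<longrightarrow>
        tops (T \<inter> window P v w) = tops (S \<inter> window P v w)) \<and>
     stack_maj a b P S = int (card (ne_chains P T))"

lemma mem_window [simp]: "(i, j) \<in> window P v w \<longleftrightarrow> (i, v) \<in> P \<and> j \<le> w"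
  by (simp add: window_def column_of_def)

lemma finite_ne_chains: "finite S \<Longrightarrow> finite (ne_chains P S)"
  by (rule finite_subset[of _ "S \<times> S"]) (auto simp: ne_chains_def)

locale stack =
  fixes P :: "cell set" and a :: int
  assumes finite_stack: "finite P"
    and left_bound': "(i, j) \<in> P \<Longrightarrow> a \<le> j"
    and row_closed: "\<lbrakk>(i, j) \<in> P; a \<le> j'; j' \<le> j\<rbrakk> \<Longrightarrow> (i, j') \<in> P"
    and column_convex: "\<lbrakk>(i, j) \<in> P; (k, j) \<in> P; m \<in> rows P; i \<le> m; m \<le> k\<rbrakk> \<Longrightarrow> (m, j) \<in> P"
begin

text \<open>A row that does not meet column \<open>v\<close> has its 1-cell to the left of
  \<open>v\<close>, hence in a column at most \<open>w\<close>. The cells of width at most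
  \<open>w\<close> outside the window are thus as many as the rows missing column \<open>v\<close>,
  whatever the filling.\<close>

lemma card_window:
  assumes S: "S \<subseteq> P" "one_per_row S" "rows S = rows P" and v: "a \<le> v" "w \<le> v" "v \<le> w + 1"
  shows "card (S \<inter> window P v w) + card (rows P - column_of P v) = card {x \<in> S. snd x \<le> w}"
proof -
  define Z where "Z = {x \<in> S. fst x \<notin> column_of P v}"
  have fin: "finite S"
    using S(1) finite_stack finite_subset by blast
  have "j \<le> w" if "(i, j) \<in> S" "(i, v) \<notin> P" for i j
    using row_closed[of i j v] v S(1) that by force
  then have "{x \<in> S. snd x \<le> w} = (S \<inter> window P v w) \<union> Z"
    by (auto simp: Z_def column_of_def)
  moreover have "(S \<inter> window P v w) \<inter> Z = {}"
    by (auto simp: Z_def column_of_def)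
  ultimately have union: "card {x \<in> S. snd x \<le> w} = card (S \<inter> window P v w) + card Z"
    using fin by (simp add: card_Un_disjoint Z_def)
  have "fst ` Z = rows S - column_of P v"
    by (force simp: Z_def rows_def)
  moreover have "inj_on fst Z"
    using S(2) by (force simp: inj_on_def Z_def one_per_row_def)
  ultimately have "card (rows P - column_of P v) = card Z"
    using S(3) card_image[of fst Z] by simp
  then show ?thesis
    using union by simp
qed

lemma finite_rows_P: "finite (rows P)"
  using finite_stack by (simp add: rows_def)

lemma mem_delete_top: "(i, j) \<in> P - top_row_cells P \<longleftrightarrow> (i, j) \<in> P \<and> i \<noteq> Min (rows P)"
  by (auto simp: top_row_cells_def)

lemma rows_delete_top: "rows (P - top_row_cells P) = rows P - {Min (rows P)}"
proof (intro set_eqI)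
  fix i show "i \<in> rows (P - top_row_cells P) \<longleftrightarrow> i \<in> rows P - {Min (rows P)}"
    unfolding rows_iff[of i "P - top_row_cells P"] mem_delete_top by (auto simp: rows_iff)
qed

lemma stack_delete_top: "stack (P - top_row_cells P) a"
proof
  show "finite (P - top_row_cells P)"
    using finite_stack by simp
  show "a \<le> j" if "(i, j) \<in> P - top_row_cells P" for i j
    using left_bound' that by blast
  show "(i, j') \<in> P - top_row_cells P" if "(i, j) \<in> P - top_row_cells P" "a \<le> j'" "j' \<le> j" for i j j'
    using row_closed[of i j j'] that unfolding mem_delete_top by blast
  show "(m, j) \<in> P - top_row_cells P" if "(i, j) \<in> P - top_row_cells P"
      "(k, j) \<in> P - top_row_cells P" "m \<in> rows (P - top_row_cells P)" "i \<le> m" "m \<le> k" for i j k m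
    using column_convex[of i j k m] that unfolding mem_delete_top rows_delete_top by blast
qed

end

text \<open>One recursion step of \<open>phi_nonempty\<close> with its intermediate objects as
  parameters. \<open>F1_eq\<close> is the closed form of the truncated Ferrers diagram obtained from
  \<open>top_ferrers_eq\<close>.\<close>

locale stack_step = stack P a for P a +
  fixes b r c :: int and S T1 P1 S1 F1 N D :: "cell set" and f :: "int \<Rightarrow> int"
  assumes S_subset: "S \<subseteq> P" and one_S: "one_per_row S" and rows_S: "rows S = rows P"
    and r_Min: "r = Min (rows P)" and top_cell: "(r, c) \<in> S"
    and right_bound: "(i, j) \<in> P \<Longrightarrow> j \<le> b"
    and P1_eq: "P1 = P - top_row_cells P" and S1_eq: "S1 = {(i, j) \<in> S. i \<noteq> r}"
    and F1_eq: "F1 = {(i, j) \<in> P1. (r, j) \<in> P}" and N_eq: "N = T1 \<inter> F1"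
    and D_eq: "D = {(i, j) \<in> F1. i \<in> rows N}" and f_eq: "f = one_col N"
    and spec1: "phi_spec a b P1 S1 T1"
begin

lemma T1_subset: "T1 \<subseteq> P1" and one_T1: "one_per_row T1" and rows_T1: "rows T1 = rows P1"
  and counts_T1: "card {x \<in> T1. snd x \<le> w} = card {x \<in> S1. snd x \<le> w}"
  and tops_T1: "\<lbrakk>w \<le> v; v \<le> w + 1; (Min (rows P1), v) \<in> P1\<rbrakk> \<Longrightarrow>
    tops (T1 \<inter> window P1 v w) = tops (S1 \<inter> window P1 v w)"
  and maj_T1: "stack_maj a b P1 S1 = int (card (ne_chains P1 T1))"
  using spec1 by (auto simp: phi_spec_def)

lemma r_le: "i \<in> rows P \<Longrightarrow> r \<le> i"
  using finite_rows_P by (simp add: r_Min)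

lemma r_c: "(r, c) \<in> P" "a \<le> c" "c \<le> b"
  using top_cell S_subset left_bound' right_bound by auto

lemma mem_P1: "(i, j) \<in> P1 \<longleftrightarrow> (i, j) \<in> P \<and> i \<noteq> r"
  by (simp only: P1_eq r_Min mem_delete_top)

lemma rows_P1: "rows P1 = rows P - {r}"
  by (simp only: P1_eq r_Min rows_delete_top)

lemma P1_above: "(i, j) \<in> P1 \<Longrightarrow> r < i"
  using r_le[of i] mem_rows[of i j P] by (force simp: mem_P1)

lemma stack_P1: "stack P1 a"
  unfolding P1_eq by (rule stack_delete_top)

lemma S1_props: "S1 \<subseteq> P1" "one_per_row S1" "rows S1 = rows P1" "S = insert (r, c) S1" "(r, c) \<notin> S1"
proof -
  show "S1 \<subseteq> P1"
    using S_subset by (auto simp: S1_eq mem_P1)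
  show "one_per_row S1"
    by (rule one_per_row_subset[OF one_S]) (auto simp: S1_eq)
  have "rows S1 = rows S - {r}"
    by (force simp: S1_eq rows_def)
  then show "rows S1 = rows P1"
    by (simp add: rows_S rows_P1)
  show "S = insert (r, c) S1" "(r, c) \<notin> S1"
    using top_cell one_S by (auto simp: S1_eq one_per_row_def)
qed

lemma mem_F1: "(i, j) \<in> F1 \<longleftrightarrow> (i, j) \<in> P \<and> i \<noteq> r \<and> (r, j) \<in> P"
  by (auto simp: F1_eq mem_P1)

lemma mem_D: "(i, j) \<in> D \<longleftrightarrow> (i, j) \<in> F1 \<and> i \<in> rows N"
  by (simp add: D_eq)

lemma rows_D: "rows D = rows N"
  by (auto simp: rows_iff D_eq N_eq)

text \<open>Column \<open>j'\<close> meets the top row \<open>r\<close> and the row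
  \<open>i\<close>, so by convexity it meets every row of the polyomino between them.\<close>

sublocale ferrers_rows D a
proof
  show "finite D"
    by (rule finite_subset[OF _ finite_stack]) (auto simp: D_eq mem_F1)
  show "a \<le> j" if "(i, j) \<in> D" for i j
    using that left_bound' by (auto simp: mem_D mem_F1)
  show "(i', j') \<in> D" if ij': "(i, j) \<in> D" "i' \<in> rows D" "i' \<le> i" "a \<le> j'" "j' \<le> j" for i j i' j'
  proof -
    have ij: "(i, j') \<in> P" "(r, j') \<in> P"
      using row_closed ij'(1,4,5) by (auto simp: mem_D mem_F1)
    obtain k where "(i', k) \<in> F1"
      using ij'(2) by (auto simp: rows_iff mem_D)
    then have "i' \<in> rows P" "i' \<noteq> r"
      using mem_rows by (auto simp: mem_F1)
    then have "(i', j') \<in> P"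
      using column_convex[OF ij(2,1)] r_le ij'(3) by blast
    then show ?thesis
      using ij \<open>i' \<noteq> r\<close> ij'(2) by (simp add: mem_D mem_F1 rows_D)
  qed
qed

lemma N_graph: "N = graph_on (rows D) f"
proof -
  have "one_per_row N"
    by (rule one_per_row_subset[OF one_T1]) (simp add: N_eq)
  then have col: "f i = j" if "(i, j) \<in> N" for i j
    unfolding f_eq one_col_def using that by (auto simp: one_per_row_def)
  have "(i, j) \<in> N \<longleftrightarrow> (i, j) \<in> graph_on (rows D) f" for i j
    using col by (auto simp: rows_D rows_iff)
  then show ?thesis
    by auto
qed

lemma valid_f: "valid f"
proof -
  have "(i, f i) \<in> N" if "i \<in> rows D" for i
    using that by (simp add: N_graph)
  then show ?thesis
    unfolding valid_def by (auto simp: mem_D rows_D N_eq)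
qed

definition outside :: "cell set" where
  "outside = T1 - F1"

lemma T1_split: "T1 = outside \<union> graph_on (rows D) f"
  using N_graph by (auto simp: outside_def N_eq)

text \<open>A row has only one 1-cell. If this is outside \<open>F1\<close>, the row is not in
  \<open>D\<close>, and its cell is in a column beyond the end of the top row.\<close>

lemma outside_mem: "(i, j) \<in> outside \<Longrightarrow> (i, j) \<in> P1 \<and> (r, j) \<notin> P \<and> i \<notin> rows D"
proof -
  assume *: "(i, j) \<in> outside"
  then have "(i, j) \<in> P1" "(i, j) \<in> T1" "(i, j) \<notin> F1"
    using T1_subset by (auto simp: outside_def)
  moreover have "i \<notin> rows N"
  proof
    assume "i \<in> rows N"
    then obtain k where "(i, k) \<in> T1" "(i, k) \<in> F1"
      by (auto simp: N_eq rows_def)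
    then show False
      using * one_T1 by (auto simp: outside_def one_per_row_def)
  qed
  ultimately show ?thesis
    by (auto simp: F1_eq rows_D)
qed

lemma valid_mem: "valid g \<Longrightarrow> i \<in> rows D \<Longrightarrow> (i, g i) \<in> P1 \<and> (r, g i) \<in> P"
  unfolding valid_def by (auto simp: mem_D F1_eq)

lemma right_of_top_row:
  assumes "(r, j) \<notin> P" "(r, j') \<in> P" "(i, j) \<in> P"
  shows "j' < j"
  using row_closed[OF assms(2), of j] left_bound'[OF assms(3)] assms(1) by force

text \<open>The cells left alone by the algorithm are to the right of the top row, so no window
  whose column \<open>v\<close> meets that row contains them.\<close>

lemma window_restrict:
  assumes "valid g" "w \<le> v" "(r, v) \<in> P"
  shows "(outside \<union> graph_on (rows D) g) \<inter> window P1 v w = window_graph g v w"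
proof -
  have "(i, j) \<notin> outside" if "j \<le> w" for i j
    using outside_mem[of i j] right_of_top_row[of j v i] that assms(2,3) by (auto simp: mem_P1)
  moreover have "(i, v) \<in> P1 \<longleftrightarrow> i \<in> column_of D v" if "i \<in> rows D" for i
    using that assms(3) by (auto simp: column_of_def mem_D F1_eq rows_D)
  moreover have "i \<in> rows D" if "i \<in> column_of D v" for i
    using column_subset_rows that by blast
  ultimately show ?thesis
    by (auto simp: window_graph_def)
qed

lemma window_P:
  "S \<inter> window P v w = (if (r, v) \<in> P \<and> c \<le> w then insert (r, c) (S1 \<inter> window P1 v w)
     else S1 \<inter> window P1 v w)"
  using S1_props(1,4) by (auto simp: mem_P1)

text \<open>Column convexity: a column meeting row \<open>r\<close> and some lower row also meets
  the row directly below \<open>r\<close>. This settles the columns on which \<open>phi_spec\<close>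
  for \<open>P1\<close> is silent.\<close>

lemma empty_window:
  assumes "(r, v) \<in> P" "(Min (rows P1), v) \<notin> P1"
  shows "window P1 v w = {}"
proof -
  have "(k, v) \<notin> P1" for k
  proof
    assume k: "(k, v) \<in> P1"
    then have "k \<in> rows P1"
      by (rule mem_rows)
    moreover have "finite (rows P1)"
      using finite_rows_P by (simp add: rows_P1)
    moreover have "rows P1 \<noteq> {}"
      using \<open>k \<in> rows P1\<close> by blast
    ultimately have "Min (rows P1) \<in> rows P1" "Min (rows P1) \<le> k"
      using Min_in[of "rows P1"] by simp_all
    then have "(Min (rows P1), v) \<in> P1"
      using column_convex[OF assms(1), of k "Min (rows P1)"] k r_le by (auto simp: mem_P1 rows_P1)
    then show False
      using assms(2) by blast
  qed
  then show ?thesis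
    by (auto simp: window_def column_of_def)
qed

lemma tops_window_S1:
  assumes "w \<le> v" "v \<le> w + 1" "(r, v) \<in> P"
  shows "tops (S1 \<inter> window P1 v w) = tops (window_graph f v w)"
proof -
  have "T1 \<inter> window P1 v w = window_graph f v w"
    using window_restrict[OF valid_f assms(1,3)] T1_split by simp
  then show ?thesis
    using tops_T1[OF assms(1,2)] empty_window[OF assms(3)] by fastforce
qed

lemma top_weight_window_S1:
  assumes "w \<le> v" "v \<le> w + 1" "(r, v) \<in> P"
  shows "top_weight k (S1 \<inter> window P1 v w) = top_weight k (window_graph f v w)"
proof -
  interpret P1: stack P1 a
    by (rule stack_P1)
  have "card (T1 \<inter> window P1 v w) = card (S1 \<inter> window P1 v w)"
    using P1.card_window[OF T1_subset one_T1 rows_T1 _ assms(1,2)]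
      P1.card_window[OF S1_props(1-3) _ assms(1,2)] left_bound'[OF assms(3)] counts_T1[of w] by simp
  then show ?thesis
    using tops_window_S1[OF assms] window_restrict[OF valid_f assms(1,3)] T1_split
    by (simp add: top_weight_def)
qed

lemma card_maj_triples_window:
  assumes "w \<le> v" "v \<le> w + 1" "a \<le> v"
  shows "card (maj_triples (S \<inter> window P v w)) = card (maj_triples (S1 \<inter> window P1 v w)) +
    (if c \<le> w then top_weight c (window_graph f v w) else 0)"
proof (cases "(r, v) \<in> P")
  case True
  define X where "X = S1 \<inter> window P1 v w"
  have "finite X"
    by (rule finite_subset[OF _ finite_stack]) (use S1_props(1) in \<open>auto simp: X_def mem_P1\<close>)
  moreover have "one_per_row X"
    by (rule one_per_row_subset[OF S1_props(2)]) (simp add: X_def)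
  moreover have "\<forall>x\<in>X. r < fst x"
    using S1_props(1) P1_above by (auto simp: X_def)
  ultimately have "card (maj_triples (insert (r, c) X)) = card (maj_triples X) + top_weight c X"
    by (rule card_maj_triples_insert)
  then show ?thesis
    using True top_weight_window_S1[OF assms(1,2) True] by (simp add: window_P X_def[symmetric])
next
  case False
  then have "column_of D v = {}"
    by (auto simp: column_of_def mem_D mem_F1)
  then have "window_graph f v w = {}"
    by (simp add: window_graph_def graph_on_def)
  then show ?thesis
    using False by (simp add: window_P)
qed

lemma stack_maj_step: "stack_maj a b P S = stack_maj a b P1 S1 + int (gain c f)"
proof -
  have "stack_maj a b P S = stack_maj a b P1 S1 + (\<Sum>w=a..b. if c \<le> w then
      int (top_weight c (window_graph f w w)) - int (top_weight c (window_graph f (w + 1) w)) else 0)"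
    unfolding stack_maj_def sum.distrib[symmetric]
    by (intro sum.cong refl) (auto simp: card_maj_triples_window)
  also have "(\<Sum>w=a..b. if c \<le> w then
      int (top_weight c (window_graph f w w)) - int (top_weight c (window_graph f (w + 1) w)) else 0)
     = (\<Sum>w=c..b. int (top_weight c (window_graph f w w)) - int (top_weight c (window_graph f (w + 1) w)))"
    using r_c(2) by (intro sum.mono_neutral_cong_right) auto
  also have "\<dots> = int (gain c f)"
  proof (rule sum_top_weight_eq_gain[OF valid_f r_c(2,3)])
    show "column_of D (b + 1) = {}"
      using right_bound by (force simp: column_of_def mem_D mem_F1)
  qed
  finally show ?thesis .
qed

section \<open>NE chains of the recombined filling\<close>

lemma finite_outside: "finite outside"
  by (rule finite_subset[OF _ finite_stack]) (use outside_mem in \<open>auto simp: mem_P1\<close>)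

lemma outside_disjoint: "outside \<inter> graph_on (rows D) g = {}"
  using outside_mem by auto

text \<open>The algorithm affects only the chains within \<open>D\<close>. A cell of
  \<open>outside\<close> is to the right of every cell of the graph, so it is never the lower cell
  of a mixed chain; as the upper cell, it forms a chain according to the row of the lower cell
  alone, whatever the column there.\<close>

lemma card_ne_chains_P1:
  assumes g: "valid g"
  shows "card (ne_chains P1 (outside \<union> graph_on (rows D) g)) =
    card (ne_chains P1 outside) + card (invs g) +
    card {(x, i). x \<in> outside \<and> i \<in> rows D \<and> fst x < i \<and> (i, snd x) \<in> P1}"
proof -
  define G where "G = graph_on (rows D) g"
  define M where "M = {(x, i). x \<in> outside \<and> i \<in> rows D \<and> fst x < i \<and> (i, snd x) \<in> P1}"
  define A where "A = (\<lambda>(i, k). ((i, g i), (k, g k))) ` invs g"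
  define B where "B = (\<lambda>(x, i). (x, (i, g i))) ` M"
  have disj: "outside \<inter> G = {}"
    unfolding G_def by (rule outside_disjoint)
  have finG: "finite (outside \<union> G)"
    using finite_outside finite_rows by (simp add: G_def finite_graph_on)
  have A: "A = ne_chains P1 G"
  proof -
    have "(k, g i) \<in> D \<longleftrightarrow> (k, g i) \<in> P1" if "i \<in> rows D" "k \<in> rows D" for i k
      using valid_mem[OF g that(1)] that(2) by (auto simp: mem_D F1_eq rows_D)
    then show ?thesis
      by (fastforce simp: A_def invs_def ne_chains_def G_def image_iff)
  qed
  have "(x, y) \<in> ne_chains P1 (outside \<union> G) \<longleftrightarrow> (x, y) \<in> ne_chains P1 outside \<union> A \<union> B" for x y
  proof -
    consider "x \<in> outside" "y \<in> outside" | "x \<in> G" "y \<in> G" | "x \<in> outside" "y \<in> G"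
      | "x \<in> G" "y \<in> outside" | "x \<notin> outside \<union> G \<or> y \<notin> outside \<union> G"
      by blast
    then show ?thesis
    proof cases
      case 1
      then have "y \<notin> G"
        using disj by blast
      then show ?thesis
        using 1 unfolding A by (auto simp: ne_chains_def B_def M_def G_def)
    next
      case 2
      then have "x \<notin> outside"
        using disj by blast
      then show ?thesis
        using 2 unfolding A by (auto simp: ne_chains_def B_def M_def)
    next
      case 3
      then obtain i where i: "i \<in> rows D" "y = (i, g i)"
        by (cases y) (auto simp: G_def)
      have "g i < snd x"
        using right_of_top_row[of "snd x" "g i" "fst x"] outside_mem[of "fst x" "snd x"] 3(1)
          valid_mem[OF g i(1)] by (cases x) (auto simp: mem_P1)
      moreover have "x \<notin> G" "y \<notin> outside"
        using 3 disj by auto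
      ultimately show ?thesis
        using 3 i unfolding A by (auto simp: ne_chains_def B_def M_def)
    next
      case 4
      then obtain i where i: "i \<in> rows D" "x = (i, g i)"
        by (cases x) (auto simp: G_def)
      have "g i < snd y"
        using right_of_top_row[of "snd y" "g i" "fst y"] outside_mem[of "fst y" "snd y"] 4(2)
          valid_mem[OF g i(1)] by (cases y) (auto simp: mem_P1)
      moreover have "x \<notin> outside" "y \<notin> G"
        using 4 disj by auto
      ultimately show ?thesis
        using 4 i unfolding A by (auto simp: ne_chains_def B_def M_def)
    next
      case 5
      then show ?thesis
        unfolding A by (auto simp: ne_chains_def B_def M_def G_def)
    qed
  qed
  then have "ne_chains P1 (outside \<union> G) = ne_chains P1 outside \<union> A \<union> B"
    by auto
  moreover have "ne_chains P1 outside \<inter> A = {}" "(ne_chains P1 outside \<union> A) \<inter> B = {}"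
    using disj unfolding A by (auto simp: ne_chains_def B_def M_def G_def)
  moreover have "finite (ne_chains P1 (outside \<union> G))"
    by (rule finite_ne_chains[OF finG])
  ultimately have "card (ne_chains P1 (outside \<union> G)) = card (ne_chains P1 outside) + card A + card B"
    by (simp add: card_Un_disjoint)
  moreover have "card A = card (invs g)" "card B = card M"
    unfolding A_def B_def by (auto intro!: card_image simp: inj_on_def)
  ultimately show ?thesis
    by (simp add: G_def M_def)
qed

text \<open>The cells of \<open>outside\<close> are to the right of column \<open>c\<close>, so the
  new cell forms chains only with left cells. For the old pairs \<open>P\<close> and
  \<open>P1\<close> agree, since the tested corner is in the row of the lower cell, never in row
  \<open>r\<close>.\<close>

lemma card_ne_chains_insert:
  assumes g: "valid g"
  shows "card (ne_chains P (insert (r, c) (outside \<union> graph_on (rows D) g))) =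
    card (ne_chains P1 (outside \<union> graph_on (rows D) g)) + card (lefts c g)"
proof -
  define X where "X = outside \<union> graph_on (rows D) g"
  define L where "L = (\<lambda>i. ((r, c), (i, g i))) ` lefts c g"
  have X: "X \<subseteq> P1"
    using outside_mem valid_mem[OF g] by (auto simp: X_def)
  have finX: "finite X"
    using finite_outside finite_rows by (simp add: X_def finite_graph_on)
  have "(x, y) \<in> ne_chains P (insert (r, c) X) \<longleftrightarrow> (x, y) \<in> ne_chains P1 X \<union> L" for x y
  proof (cases "x = (r, c)")
    case True
    have "x \<notin> X"
      using X True by (auto simp: mem_P1)
    have "y \<in> X \<and> snd y < c \<and> (fst y, c) \<in> P \<longleftrightarrow> (\<exists>i\<in>lefts c g. y = (i, g i))"
    proof
      assume y: "y \<in> X \<and> snd y < c \<and> (fst y, c) \<in> P"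
      have "y \<notin> outside"
        using right_of_top_row[of "snd y" c "fst y"] outside_mem[of "fst y" "snd y"] r_c(1) y
        by (cases y) (auto simp: mem_P1)
      then obtain i where "i \<in> rows D" "y = (i, g i)"
        using y by (cases y) (auto simp: X_def)
      moreover have "i \<noteq> r"
        using X y calculation(2) by (auto simp: mem_P1)
      ultimately show "\<exists>i\<in>lefts c g. y = (i, g i)"
        using y r_c(1) by (auto simp: lefts_def column_of_def mem_D mem_F1 rows_D)
    next
      assume "\<exists>i\<in>lefts c g. y = (i, g i)"
      then obtain i where i: "i \<in> column_of D c" "g i < c" "y = (i, g i)"
        by (auto simp: lefts_def)
      then have "i \<in> rows D" "(i, c) \<in> P"
        using column_subset_rows by (auto simp: column_of_def mem_D mem_F1)
      then show "y \<in> X \<and> snd y < c \<and> (fst y, c) \<in> P"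
        using i by (auto simp: X_def)
    qed
    moreover have "r < fst y" if "y \<in> X"
      using X P1_above[of "fst y" "snd y"] that by auto
    ultimately show ?thesis
      using True \<open>x \<notin> X\<close> by (auto simp: ne_chains_def L_def)
  next
    case False
    have "r < fst x" if "x \<in> X"
      using X P1_above[of "fst x" "snd x"] that by auto
    moreover have "(fst y, snd x) \<in> P \<longleftrightarrow> (fst y, snd x) \<in> P1" if "y \<in> X"
      using X P1_above[of "fst y" "snd y"] that by (auto simp: mem_P1)
    ultimately show ?thesis
      using False by (cases "y = (r, c)") (auto simp: ne_chains_def L_def dest: P1_above)
  qed
  then have "ne_chains P (insert (r, c) X) = ne_chains P1 X \<union> L"
    by auto
  moreover have "ne_chains P1 X \<inter> L = {}"
    using X by (auto simp: ne_chains_def L_def mem_P1)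
  moreover have "finite L"
    by (simp add: L_def lefts_def finite_column)
  moreover have "card L = card (lefts c g)"
    unfolding L_def by (intro card_image) (simp add: inj_on_def)
  ultimately show ?thesis
    using finX by (simp add: card_Un_disjoint finite_ne_chains X_def)
qed

lemma phi_spec_step:
  assumes g: "valid g" and le: "left_equiv c (column_of D c) f g"
    and count: "card (invs g) + card (lefts c f) = card (invs f) + gain c f"
  shows "phi_spec a b P S (insert (r, c) (outside \<union> graph_on (rows D) g))"
proof -
  define X where "X = outside \<union> graph_on (rows D) g"
  have X: "X \<subseteq> P1"
    using outside_mem valid_mem[OF g] by (auto simp: X_def)
  have finX: "finite X"
    using finite_outside finite_rows by (simp add: X_def finite_graph_on)
  obtain p where p: "p permutes column_of D c" "g = f \<circ> p"
    using le by (auto simp: left_equiv_def)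
  have p': "p permutes rows D"
    using permutes_subset[OF p(1) column_subset_rows] .
  have rc: "(r, c) \<notin> X"
    using X by (auto simp: mem_P1)
  have "insert (r, c) X \<subseteq> P"
    using X r_c(1) by (auto simp: mem_P1)
  moreover have "one_per_row (insert (r, c) X)"
  proof -
    have "one_per_row outside"
      by (rule one_per_row_subset[OF one_T1]) (simp add: outside_def)
    moreover have "one_per_row (graph_on (rows D) g)"
      by (auto simp: one_per_row_def)
    ultimately have "one_per_row X"
      using outside_mem unfolding one_per_row_def X_def by fastforce
    then show ?thesis
      using X by (auto simp: one_per_row_def mem_P1)
  qed
  moreover have "rows (insert (r, c) X) = rows P"
  proof -
    have "rows X = rows outside \<union> rows D"
      by (simp add: X_def rows_Un)
    moreover have "rows T1 = rows outside \<union> rows D"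
      using arg_cong[OF T1_split, of rows] by (simp add: rows_Un)
    ultimately have "rows X = rows P - {r}"
      using rows_T1 rows_P1 by simp
    moreover have "r \<in> rows P"
      using r_c(1) mem_rows by blast
    ultimately show ?thesis
      by (auto simp: rows_def)
  qed
  moreover have "card {x \<in> insert (r, c) X. snd x \<le> w} = card {x \<in> S. snd x \<le> w}" for w
  proof -
    have union: "card {x \<in> outside \<union> graph_on (rows D) h. snd x \<le> w} =
        card {x \<in> outside. snd x \<le> w} + card {i \<in> rows D. h i \<le> w}" for h
    proof -
      have "{x \<in> outside \<union> graph_on (rows D) h. snd x \<le> w} =
          {x \<in> outside. snd x \<le> w} \<union> graph_on {i \<in> rows D. h i \<le> w} h"
        by auto
      moreover have "{x \<in> outside. snd x \<le> w} \<inter> graph_on {i \<in> rows D. h i \<le> w} h = {}"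
        using outside_mem by auto
      ultimately show ?thesis
        using finite_outside finite_rows by (simp add: card_Un_disjoint finite_graph_on)
    qed
    have "card {i \<in> rows D. g i \<le> w} = card {i \<in> rows D. f i \<le> w}"
      using card_permuted[OF p' finite_rows, of "\<lambda>i. f i \<le> w"] by (simp add: p(2))
    then have "card {x \<in> X. snd x \<le> w} = card {x \<in> T1. snd x \<le> w}"
      using union[of f] union[of g] T1_split by (simp add: X_def)
    then have "card {x \<in> X. snd x \<le> w} = card {x \<in> S1. snd x \<le> w}"
      by (simp add: counts_T1)
    moreover have "card {x \<in> insert (r, c) Y. snd x \<le> w} = card {x \<in> Y. snd x \<le> w} + of_bool (c \<le> w)"
      if "finite Y" "(r, c) \<notin> Y" for Y
    proof -
      have "{x \<in> insert (r, c) Y. snd x \<le> w} =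
          (if c \<le> w then insert (r, c) {x \<in> Y. snd x \<le> w} else {x \<in> Y. snd x \<le> w})"
        by auto
      then show ?thesis
        using that by simp
    qed
    moreover have "finite S1"
      using S1_props(1) finite_stack finite_subset[of S1 P] by (auto simp: P1_eq)
    ultimately show ?thesis
      using finX rc S1_props(4,5) by simp
  qed
  moreover have "tops (insert (r, c) X \<inter> window P v w) = tops (S \<inter> window P v w)"
    if vw: "w \<le> v" "v \<le> w + 1" "(Min (rows P), v) \<in> P" for v w
  proof -
    have v: "(r, v) \<in> P"
      using vw(3) by (simp add: r_Min)
    have XP: "insert (r, c) X \<inter> window P v w =
        (if c \<le> w then insert (r, c) (X \<inter> window P1 v w) else X \<inter> window P1 v w)"
      using X v by (auto simp: mem_P1)
    show ?thesis
    proof (cases "c \<le> w")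
      case True
      \<comment> \<open>Once the new cell is visible it is the topmost one, so the rearrangement
        below it has no influence.\<close>
      have "tops (insert (r, c) Y) = {c}" if "Y \<subseteq> P1" for Y
      proof -
        have "(i, j) = (r, c)" if "(i, j) \<in> insert (r, c) Y" "\<forall>x\<in>insert (r, c) Y. i \<le> fst x" for i j
          using that P1_above \<open>Y \<subseteq> P1\<close> by force
        moreover have "r \<le> fst x" if "x \<in> insert (r, c) Y" for x
          using that P1_above[of "fst x" "snd x"] \<open>Y \<subseteq> P1\<close> by auto
        ultimately show ?thesis
          unfolding tops_def by blast
      qed
      then show ?thesis
        using True v X S1_props(1) unfolding XP window_P by (simp add: le_infI1)
    next
      case False
      \<comment> \<open>From \<open>w < c\<close> and \<open>v \<le> w + 1\<close> follows
        \<open>v \<le> c\<close>. So every row permuted by the algorithm meets column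
        \<open>v\<close>, which is the condition on \<open>J\<close> in
        \<open>left_equiv\<close>.\<close>
      then have "column_of D c \<subseteq> column_of D v"
        using vw(2) column_mono[of v c] left_bound'[OF v] by simp
      then have "tops (window_graph f v w) = tops (window_graph g v w)"
        using le column_subset_rows[of v] False unfolding left_equiv_def window_graph_def by auto
      then show ?thesis
        using False window_restrict[OF g vw(1) v] tops_window_S1[OF vw(1,2) v]
        unfolding XP window_P by (simp add: X_def)
    qed
  qed
  moreover have "stack_maj a b P S = int (card (ne_chains P (insert (r, c) X)))"
  proof -
    have "card (lefts c g) = card (lefts c f)"
      using card_permuted[OF p(1) finite_column, of "\<lambda>i. f i < c"] by (simp add: lefts_def p(2))
    then have "card (ne_chains P (insert (r, c) X)) = card (ne_chains P1 T1) + gain c f"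
      using card_ne_chains_insert[OF g] card_ne_chains_P1[OF g] card_ne_chains_P1[OF valid_f] T1_split count
      by (simp add: X_def)
    then show ?thesis
      using stack_maj_step maj_T1 by simp
  qed
  ultimately show ?thesis
    unfolding phi_spec_def X_def by blast
qed

end

section \<open>The maximal Ferrers diagram and the induction on the number of rows\<close>

locale full_stack = stack P a for P a +
  assumes connected_rows: "connected_line (rows P)"
begin

text \<open>A Ferrers diagram inside \<open>P\<close> that contains the top row is top-aligned at
  that row, so all its columns reach it. The cells in such columns already form a Ferrers diagram,
  hence the greatest one exists.\<close>

lemma top_ferrers_eq:
  assumes "rows P \<noteq> {}"
  shows "top_ferrers P = {(i, j) \<in> P. (Min (rows P), j) \<in> P}"
proof -
  define r where "r = Min (rows P)"
  define F where "F = {(i, j) \<in> P. (r, j) \<in> P}"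
  have r: "r \<in> rows P"
    unfolding r_def by (rule Min_in[OF finite_rows_P assms])
  have r_le: "r \<le> i" if "(i, j) \<in> P" for i j
    unfolding r_def using that finite_rows_P mem_rows by (intro Min_le) auto
  have mem_F: "(i, j) \<in> F \<longleftrightarrow> (i, j) \<in> P \<and> (r, j) \<in> P" for i j
    by (simp add: F_def)
  have F_closed: "(i, j') \<in> F" if "(i, j) \<in> F" "a \<le> j'" "j' \<le> j" for i j j'
    using row_closed that by (auto simp: mem_F)
  have conn: "connected_line (column_of F j)" for j
    unfolding connected_line_def
  proof (intro ballI subsetI)
    fix x y z assume xyz: "x \<in> column_of F j" "y \<in> column_of F j" "z \<in> {x..y}"
    then have "(x, j) \<in> P" "(y, j) \<in> P" "(r, j) \<in> P"
      by (auto simp: column_of_def mem_F)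
    moreover from this have "{x..y} \<subseteq> rows P"
      using connected_rows mem_rows unfolding connected_line_def by blast
    ultimately show "z \<in> column_of F j"
      using column_convex[of x j y z] xyz(3) by (auto simp: column_of_def mem_F)
  qed
  have "connected_line (row_of F i)" for i
    unfolding connected_line_def
  proof (intro ballI subsetI)
    fix x y z assume xyz: "x \<in> row_of F i" "y \<in> row_of F i" "z \<in> {x..y}"
    then have "(i, y) \<in> F" "a \<le> x"
      using left_bound'[of i x] by (auto simp: row_of_def mem_F)
    then show "z \<in> row_of F i"
      using F_closed[of i y z] xyz(3) by (auto simp: row_of_def)
  qed
  moreover have "finite F"
    by (rule finite_subset[OF _ finite_stack]) (auto simp: mem_F)
  moreover have "intersection_free F"
  proof -
    have "column_of F j' \<subseteq> column_of F j" if "a \<le> j" "j \<le> j'" for j j'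
      using F_closed that by (auto simp: column_of_def)
    moreover have "column_of F j = {}" if "j < a" for j
      using left_bound' that by (force simp: column_of_def mem_F)
    moreover have "j < a \<or> j' < a \<or> a \<le> j \<and> j \<le> j' \<or> a \<le> j' \<and> j' \<le> j" for j j'
      by linarith
    ultimately show ?thesis
      unfolding intersection_free_def by (metis empty_subsetI)
  qed
  moreover have "left_aligned F"
    unfolding left_aligned_def
  proof (intro exI[of _ a] ballI, clarify)
    fix i j assume "(i, j) \<in> F"
    moreover from this have "a \<le> j"
      using left_bound' by (auto simp: mem_F)
    ultimately show "a \<le> j \<and> (i, a) \<in> F"
      using F_closed by blast
  qed
  moreover have "top_aligned F"
    unfolding top_aligned_def
    by (rule exI[of _ r]) (use r_le in \<open>auto simp: mem_F\<close>)
  ultimately have "ferrers F"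
    by (simp add: ferrers_def moon_polyomino_def convex_polyomino_def conn)
  moreover have "F \<subseteq> P" "top_row_cells P \<subseteq> F"
    by (auto simp: mem_F top_row_cells_def r_def)
  moreover have "G \<subseteq> F" if G: "ferrers G" "G \<subseteq> P" "top_row_cells P \<subseteq> G" for G
  proof -
    obtain t where t: "\<And>i j. (i, j) \<in> G \<Longrightarrow> t \<le> i \<and> (t, j) \<in> G"
      using G(1) unfolding ferrers_def top_aligned_def by blast
    obtain j where "(r, j) \<in> P"
      using r by (auto simp: rows_iff)
    then have "(r, j) \<in> G"
      using G(3) by (auto simp: top_row_cells_def r_def)
    then have "t = r"
      using t[of r j] r_le[of t j] G(2) by force
    then have "(i, j) \<in> F" if "(i, j) \<in> G" for i j
      using t[OF that] that G(2) unfolding mem_F by blast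
    then show ?thesis
      by auto
  qed
  ultimately have "top_ferrers P = F"
    unfolding top_ferrers_def by (intro Greatest_equality) auto
  then show ?thesis
    by (simp add: F_def r_def)
qed

end

lemma phi_spec_single_row:
  assumes "stack P a" "S \<subseteq> P" "one_per_row S" "rows S = rows P" "card (rows P) \<le> 1"
  shows "phi_spec a b P S S"
proof -
  have "finite (rows P)"
    using stack.finite_rows_P[OF assms(1)] .
  then have "\<forall>i\<in>rows P. \<forall>k\<in>rows P. i = k"
    using card_le_Suc0_iff_eq[of "rows P"] assms(5) by simp
  then have eq: "\<not> fst x < fst y" if "x \<in> S" "y \<in> S" for x y
    using that assms(4) mem_rows[of "fst x" "snd x" S] mem_rows[of "fst y" "snd y" S] by force
  have "ne_chains P S = {}"
    using eq unfolding ne_chains_def by blast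
  moreover have "maj_triples (S \<inter> Z) = {}" for Z
    using eq unfolding maj_triples_def descents_def by blast
  ultimately show ?thesis
    using assms by (simp add: phi_spec_def stack_maj_def)
qed

lemma phi_nonempty_spec:
  assumes "full_stack P a" "\<forall>(i, j)\<in>P. j \<le> b" "S \<subseteq> P" "one_per_row S" "rows S = rows P"
  shows "phi_spec a b P S (phi_nonempty P S)"
  using assms
proof (induction "card (rows P)" arbitrary: P S rule: less_induct)
  case less
  note prems = less.prems
  interpret full_stack P a
    by (rule prems(1))
  show ?case
  proof (cases "card (rows P) \<le> 1")
    case True
    then show ?thesis
      using phi_spec_single_row[OF stack_axioms prems(3-5)] by (simp add: phi_nonempty.simps)
  next
    case False
    define r where "r = Min (rows P)"
    define c where "c = one_col S r"
    define P1 where "P1 = P - top_row_cells P"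
    define S1 where "S1 = {(i, j) \<in> S. i \<noteq> r}"
    define T1 where "T1 = phi_nonempty P1 S1"
    define F1 where "F1 = {(i, j) \<in> P1. (r, j) \<in> P}"
    define N where "N = T1 \<inter> F1"
    define D where "D = {(i, j) \<in> F1. i \<in> rows N}"
    have ne: "rows P \<noteq> {}"
      using False by auto
    have r: "r \<in> rows P"
      unfolding r_def by (rule Min_in[OF finite_rows_P ne])
    have r_le: "r \<le> i" if "i \<in> rows P" for i
      unfolding r_def using that finite_rows_P by simp
    obtain c' where c': "(r, c') \<in> S"
      using r prems(5) by (metis rows_iff)
    then have "c = c'"
      using prems(4) unfolding c_def one_col_def one_per_row_def by blast
    then have rc: "(r, c) \<in> S"
      using c' by simp
    have rowsP1: "rows P1 = rows P - {r}"
      unfolding P1_def r_def by (rule rows_delete_top)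
    have spec1: "phi_spec a b P1 S1 T1"
      unfolding T1_def
    proof (rule less.hyps)
      show "card (rows P1) < card (rows P)"
        using r finite_rows_P by (simp add: rowsP1 card_gt_0_iff ne)
      show "full_stack P1 a"
      proof (intro full_stack.intro full_stack_axioms.intro)
        show "stack P1 a"
          unfolding P1_def by (rule stack_delete_top)
        show "connected_line (rows P1)"
          using connected_rows r_le unfolding connected_line_def rowsP1 by force
      qed
      show "\<forall>(i, j)\<in>P1. j \<le> b"
        using prems(2) by (auto simp: P1_def)
      show "S1 \<subseteq> P1"
        using prems(3) by (auto simp: S1_def P1_def top_row_cells_def r_def)
      show "one_per_row S1"
        by (rule one_per_row_subset[OF prems(4)]) (auto simp: S1_def)
      have "rows S1 = rows S - {r}"
        by (auto simp: S1_def rows_iff)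
      then show "rows S1 = rows P1"
        by (simp add: rowsP1 prems(5))
    qed
    interpret stack_step P a b r c S T1 P1 S1 F1 N D "one_col N"
      using prems rc spec1
      by unfold_locales (auto simp: r_def P1_def S1_def F1_def N_def D_def)
    obtain g where g: "gamma D c N = graph_on (rows D) g" "valid g"
        "left_equiv c (column_of D c) (one_col N) g"
        "card (invs g) + card (lefts c (one_col N)) = card (invs (one_col N)) + gain c (one_col N)"
      using gamma_graph[OF valid_f r_c(2)] N_graph by auto
    have F1: "top_ferrers P - top_row_cells P = F1"
      unfolding top_ferrers_eq[OF ne] F1_def P1_def r_def by auto
    have top: "{(i, j) \<in> S. i = r} = {(r, c)}"
      using rc prems(4) by (auto simp: one_per_row_def)
    have "phi_nonempty P S = (T1 - F1) \<union> gamma D c N \<union> {(i, j) \<in> S. i = r}"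
      using False unfolding phi_nonempty.simps[of P S] Let_def
      by (simp only: r_def[symmetric] F1 P1_def[symmetric] S1_def[symmetric] T1_def[symmetric]
          N_def[symmetric] D_def[symmetric] c_def[symmetric] if_False)
    also have "\<dots> = insert (r, c) (outside \<union> graph_on (rows D) g)"
      unfolding g(1) top outside_def by auto
    finally show ?thesis
      using phi_spec_step[OF g(2-4)] by simp
  qed
qed

section \<open>The major index of a rectangle as a number of triples\<close>

lemma one_col_mem: "one_per_row X \<Longrightarrow> i \<in> rows X \<Longrightarrow> (i, one_col X i) \<in> X"
  unfolding one_col_def rows_iff one_per_row_def by (metis (mono_tags, lifting) theI')

text \<open>Neighbouring positions in the sorted list of nonempty rows are the pairs of 1-cells with
  no 1-cell in a row strictly between. The premise \<open>chain\<close> expresses that within a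
  rectangle the spanned rectangle is always contained.\<close>

lemma des_eq_card_descents:
  assumes fin: "finite Y" and one: "one_per_row Y"
    and chain: "\<And>x y. x \<in> Y \<Longrightarrow> y \<in> Y \<Longrightarrow> is_NE_chain Q x y \<longleftrightarrow> fst x < fst y \<and> snd y < snd x"
  shows "des Q Y = card (descents Y)"
proof -
  define rs where "rs = sorted_list_of_set (rows Y)"
  define cell_at where "cell_at k = (rs ! k, one_col Y (rs ! k))" for k
  define B where "B = {k. Suc k < length rs \<and> is_NE_chain Q (cell_at k) (cell_at (Suc k))}"
  have "finite (rows Y)"
    using fin by (simp add: rows_def)
  then have set_rs: "set rs = rows Y" and sorted: "sorted_wrt (<) rs"
    by (simp_all add: rs_def)
  have less: "rs ! k < rs ! m \<longleftrightarrow> k < m" if "k < length rs" "m < length rs" for k m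
    using sorted_wrt_nth_less[OF sorted] that by (metis linorder_neqE_nat order_less_asym order_less_irrefl)
  have cell: "cell_at k \<in> Y" if "k < length rs" for k
    using one_col_mem[OF one, of "rs ! k"] that set_rs nth_mem by (auto simp: cell_at_def)
  have index: "\<exists>k<length rs. x = cell_at k" if "x \<in> Y" for x
  proof -
    obtain i j where ij: "x = (i, j)"
      by fastforce
    then have i: "i \<in> rows Y"
      using that mem_rows by blast
    then obtain k where k: "k < length rs" "rs ! k = i"
      using set_rs by (metis in_set_conv_nth)
    have "j = one_col Y i"
      using one_col_mem[OF one i] one that ij unfolding one_per_row_def by blast
    then show ?thesis
      using k ij by (auto simp: cell_at_def)
  qed
  have fst_cell [simp]: "fst (cell_at k) = rs ! k" for k
    by (simp add: cell_at_def)
  have "(\<lambda>k. (cell_at k, cell_at (Suc k))) ` B = descents Y"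
  proof (intro equalityI subsetI)
    fix p assume "p \<in> (\<lambda>k. (cell_at k, cell_at (Suc k))) ` B"
    then obtain k where k: "Suc k < length rs" "is_NE_chain Q (cell_at k) (cell_at (Suc k))"
      and p: "p = (cell_at k, cell_at (Suc k))"
      by (auto simp: B_def)
    have in_Y: "cell_at k \<in> Y" "cell_at (Suc k) \<in> Y"
      using cell k(1) by auto
    have "\<not> (rs ! k < fst z \<and> fst z < rs ! Suc k)" if z: "z \<in> Y" for z
    proof -
      obtain m where "m < length rs" "z = cell_at m"
        using index[OF z] by blast
      then show ?thesis
        using less[of k m] less[of m "Suc k"] k(1) by auto
    qed
    then show "p \<in> descents Y"
      using chain[OF in_Y] in_Y k(2) by (simp add: p descents_def)
  next
    fix p assume "p \<in> descents Y"
    then obtain x y where p: "p = (x, y)" "x \<in> Y" "y \<in> Y" "fst x < fst y" "snd y < snd x"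
      and no: "\<forall>z\<in>Y. \<not> (fst x < fst z \<and> fst z < fst y)"
      by (auto simp: descents_def)
    obtain k m where km: "k < length rs" "x = cell_at k" "m < length rs" "y = cell_at m"
      using index p(2,3) by blast
    then have "k < m"
      using p(4) less[of k m] by simp
    moreover have "\<not> Suc k < m"
    proof
      assume "Suc k < m"
      then have "cell_at (Suc k) \<in> Y" "rs ! k < rs ! Suc k" "rs ! Suc k < rs ! m"
        using cell less km by auto
      then show False
        using no km by force
    qed
    ultimately have "m = Suc k"
      by simp
    then show "p \<in> (\<lambda>k. (cell_at k, cell_at (Suc k))) ` B"
      using chain[OF p(2,3)] km p by (auto simp: B_def)
  qed
  moreover have "inj_on (\<lambda>k. (cell_at k, cell_at (Suc k))) B"
  proof (rule inj_onI)
    fix k m assume km: "k \<in> B" "m \<in> B" "(cell_at k, cell_at (Suc k)) = (cell_at m, cell_at (Suc m))"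
    then have "rs ! k = rs ! m"
      by (simp add: cell_at_def)
    then show "k = m"
      using less[of k m] less[of m k] km(1,2) by (auto simp: B_def)
  qed
  ultimately have "card (descents Y) = card B"
    using card_image by fastforce
  then show ?thesis
    by (simp add: des_def Let_def B_def rs_def cell_at_def)
qed

text \<open>Double counting of pairs of a nonempty row and a descent weakly above it. Cutting off
  the lower rows only discards the descents that end there, and the cell marking a row is determined
  by the row.\<close>

lemma maj_rect_eq:
  assumes R: "R = A \<times> {l..u}" "connected_line A" and X: "finite X" "X \<subseteq> R" "one_per_row X"
  shows "maj_rect R X = card (maj_triples X)"
proof -
  have fin: "finite (descents X)"
    by (rule finite_subset[of _ "X \<times> X"]) (use X(1) in \<open>auto simp: descents_def\<close>)
  have mem_upto: "x \<in> upto_row X r \<longleftrightarrow> x \<in> X \<and> fst x \<le> r" for x r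
    by (cases x) (simp add: upto_row_def)
  have "des (upto_row R r) (upto_row X r) = card {(x, y) \<in> descents X. fst y \<le> r}" for r
  proof -
    have "des (upto_row R r) (upto_row X r) = card (descents (upto_row X r))"
    proof (rule des_eq_card_descents)
      show "finite (upto_row X r)"
        by (rule finite_subset[OF _ X(1)]) (auto simp: upto_row_def)
      show "one_per_row (upto_row X r)"
        by (rule one_per_row_subset[OF X(3)]) (auto simp: upto_row_def)
      fix x y assume "x \<in> upto_row X r" "y \<in> upto_row X r"
      then have "x \<in> A \<times> {l..u}" "y \<in> A \<times> {l..u}" "fst y \<le> r"
        using X(2) R(1) by (auto simp: mem_upto)
      then have "fst x \<in> A" "fst y \<in> A" "{snd y..snd x} \<subseteq> {l..u}" "fst y \<le> r"
        by auto
      moreover from this have "{fst x..fst y} \<subseteq> A"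
        using R(2) unfolding connected_line_def by blast
      ultimately have "{fst x..fst y} \<subseteq> A" "{snd y..snd x} \<subseteq> {l..u}" "fst y \<le> r"
        by blast+
      then have "{fst x..fst y} \<times> {snd y..snd x} \<subseteq> upto_row R r"
        by (force simp: upto_row_def R(1))
      then show "is_NE_chain (upto_row R r) x y \<longleftrightarrow> fst x < fst y \<and> snd y < snd x"
        by (simp add: is_NE_chain_def)
    qed
    moreover have "descents (upto_row X r) = {(x, y) \<in> descents X. fst y \<le> r}"
      unfolding descents_def mem_upto by (auto simp: mem_upto)
    ultimately show ?thesis
      by simp
  qed
  then have "maj_rect R X = card (Sigma (rows X) (\<lambda>r. {(x, y) \<in> descents X. fst y \<le> r}))"
    using X(1) fin by (simp add: maj_rect_def rows_def finite_subset[OF _ fin] case_prod_unfold)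
  also have "\<dots> = card (maj_triples X)"
  proof -
    define \<psi> :: "cell \<times> cell \<times> cell \<Rightarrow> int \<times> cell \<times> cell" where "\<psi> = (\<lambda>(x, y, z). (fst z, (x, y)))"
    have "\<psi> ` maj_triples X = Sigma (rows X) (\<lambda>r. {(x, y) \<in> descents X. fst y \<le> r})"
      by (force simp: \<psi>_def maj_triples_def rows_def)
    moreover have "inj_on \<psi> (maj_triples X)"
      using X(3) by (force simp: inj_on_def \<psi>_def maj_triples_def one_per_row_def)
    ultimately show ?thesis
      using card_image by metis
  qed
  finally show ?thesis .
qed

lemma (in linorder) sorted_key_list_of_set_eqI:
  assumes "inj_on f A" "finite A" "sorted_wrt (<) (map f l)" "set l = A" "length l = card A"
  shows "sorted_key_list_of_set f A = l"
proof -
  interpret folding_insort_key "(\<le>)" "(<)" A f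
    by unfold_locales (rule assms(1))
  show ?thesis
    using sorted_key_list_of_set_unique[OF subset_refl assms(2)] assms(3-5) by blast
qed

section \<open>The major index as a sum over widths\<close>

context full_stack
begin

lemma column_mono': "a \<le> j \<Longrightarrow> j \<le> j' \<Longrightarrow> column_of P j' \<subseteq> column_of P j"
  unfolding column_of_def using row_closed by blast

lemma finite_column': "finite (column_of P j)"
  by (rule finite_subset[OF _ finite_rows_P]) (auto simp: column_of_def mem_rows)

lemma connected_column: "connected_line (column_of P j)"
  unfolding connected_line_def
proof (intro ballI subsetI)
  fix x y z assume xyz: "x \<in> column_of P j" "y \<in> column_of P j" "z \<in> {x..y}"
  then have P: "(x, j) \<in> P" "(y, j) \<in> P"
    by (auto simp: column_of_def)
  then have "{x..y} \<subseteq> rows P"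
    using connected_rows mem_rows unfolding connected_line_def by blast
  then show "z \<in> column_of P j"
    using column_convex[OF P, of z] xyz(3) by (auto simp: column_of_def)
qed

definition col_rect :: "int \<Rightarrow> cell set" where
  "col_rect w = column_of P w \<times> {a..w}"

text \<open>The right ends of the maximal rectangles: \<open>col_rect w\<close> can be widened
  without losing rows exactly when columns \<open>w\<close> and \<open>w + 1\<close> agree.\<close>

definition corners :: "int set" where
  "corners = {w. a \<le> w \<and> column_of P (w + 1) \<noteq> column_of P w}"

lemma col_rect_subset: "col_rect w \<subseteq> P"
  unfolding col_rect_def column_of_def using row_closed by auto

lemma rectangle_col_rect:
  assumes "a \<le> w" "column_of P w \<noteq> {}"
  shows "rectangle (col_rect w)"
proof -
  let ?I = "column_of P w"
  have m: "Min ?I \<in> ?I" "Max ?I \<in> ?I"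
    using Min_in Max_in finite_column' assms(2) by auto
  then have "{Min ?I..Max ?I} \<subseteq> ?I"
    using connected_column unfolding connected_line_def by blast
  moreover have "?I \<subseteq> {Min ?I..Max ?I}"
    using finite_column' by auto
  ultimately have "?I = {Min ?I..Max ?I}"
    by blast
  moreover have "Min ?I \<le> Max ?I"
    using m finite_column' by simp
  ultimately show ?thesis
    unfolding rectangle_def col_rect_def using assms(1) by blast
qed

lemma subset_col_rect:
  assumes "{x..y} \<times> {u..v} \<subseteq> P" "x \<le> y" "u \<le> v"
  shows "a \<le> u" "{x..y} \<subseteq> column_of P v" "{x..y} \<times> {u..v} \<subseteq> col_rect v"
proof -
  have "(x, u) \<in> P"
    using assms by auto
  then show "a \<le> u"
    by (rule left_bound')
  show "{x..y} \<subseteq> column_of P v"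
    using assms by (auto simp: column_of_def)
  then show "{x..y} \<times> {u..v} \<subseteq> col_rect v"
    using \<open>a \<le> u\<close> by (auto simp: col_rect_def)
qed

lemma corner_column:
  assumes "w \<in> corners"
  shows "column_of P (w + 1) \<subset> column_of P w"
  using assms column_mono'[of w "w + 1"] by (auto simp: corners_def)

text \<open>A rectangle ending in column \<open>v\<close> is contained in \<open>col_rect v\<close>,
  so a maximal one equals it. Conversely, a rectangle reaching beyond a corner \<open>w\<close> has
  all its rows in column \<open>w + 1\<close> and misses a row of \<open>col_rect w\<close>.\<close>

lemma maximal_rectangles_eq: "maximal_rectangles P = col_rect ` corners"
proof (intro equalityI subsetI)
  fix Q assume "Q \<in> maximal_rectangles P"
  then have Q: "rectangle Q" "Q \<subseteq> P"
    and max: "\<And>R. rectangle R \<Longrightarrow> R \<subseteq> P \<Longrightarrow> Q \<subseteq> R \<Longrightarrow> R = Q"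
    by (auto simp: maximal_rectangles_def)
  obtain x y u v where xy: "x \<le> y" "u \<le> v" and Q_eq: "Q = {x..y} \<times> {u..v}"
    using Q(1) by (auto simp: rectangle_def)
  note sub = subset_col_rect[OF Q(2)[unfolded Q_eq] xy]
  have v: "a \<le> v" "column_of P v \<noteq> {}"
    using sub(1,2) xy by auto
  have Qv: "Q = col_rect v"
    using max[OF rectangle_col_rect[OF v] col_rect_subset] sub(3) by (simp add: Q_eq)
  have "column_of P (v + 1) \<noteq> column_of P v"
  proof
    assume eq: "column_of P (v + 1) = column_of P v"
    have "Q \<subseteq> col_rect (v + 1)"
      by (auto simp: Qv col_rect_def eq)
    then have "col_rect (v + 1) = Q"
      using max[OF rectangle_col_rect col_rect_subset] v eq by simp
    moreover have "(x, v + 1) \<in> col_rect (v + 1)"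
      using v(1) eq sub(2) xy(1) by (auto simp: col_rect_def)
    ultimately show False
      by (auto simp: Q_eq)
  qed
  then show "Q \<in> col_rect ` corners"
    using v(1) by (auto simp: Qv corners_def)
next
  fix Q assume "Q \<in> col_rect ` corners"
  then obtain w where w: "w \<in> corners" "Q = col_rect w"
    by blast
  have aw: "a \<le> w"
    using w(1) by (simp add: corners_def)
  obtain k where k: "k \<in> column_of P w"
    using corner_column[OF w(1)] by blast
  have "R = Q" if R: "rectangle R" "R \<subseteq> P" "Q \<subseteq> R" for R
  proof -
    obtain x y u v where xy: "x \<le> y" "u \<le> v" and R_eq: "R = {x..y} \<times> {u..v}"
      using R(1) by (auto simp: rectangle_def)
    note sub = subset_col_rect[OF R(2)[unfolded R_eq] xy]
    have in_R: "(i, w) \<in> R" if "i \<in> column_of P w" for i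
      using R(3) that aw by (auto simp: w(2) col_rect_def)
    then have "w \<le> v"
      using k by (auto simp: R_eq)
    moreover have "\<not> w < v"
    proof
      assume "w < v"
      have "column_of P w \<subseteq> {x..y}"
        using in_R by (auto simp: R_eq)
      also have "\<dots> \<subseteq> column_of P v"
        by (rule sub(2))
      also have "\<dots> \<subseteq> column_of P (w + 1)"
        using column_mono'[of "w + 1" v] aw \<open>w < v\<close> by simp
      finally show False
        using corner_column[OF w(1)] by blast
    qed
    ultimately have "v = w"
      by simp
    then show ?thesis
      using sub(3) R(3) by (simp add: R_eq w(2))
  qed
  moreover have "rectangle Q" "Q \<subseteq> P"
    using rectangle_col_rect[OF aw] k col_rect_subset by (auto simp: w(2))
  ultimately show "Q \<in> maximal_rectangles P"
    by (auto simp: maximal_rectangles_def)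
qed

lemma finite_corners: "finite corners"
proof -
  have "corners \<subseteq> snd ` P"
    using corner_column by (force simp: column_of_def)
  then show ?thesis
    using finite_stack finite_subset by blast
qed

lemma height_col_rect: "a \<le> w \<Longrightarrow> height (col_rect w) = card (column_of P w)"
proof -
  assume "a \<le> w"
  then have "rows (col_rect w) = column_of P w"
    by (auto simp: col_rect_def rows_iff)
  then show ?thesis
    by (simp add: height_def)
qed

lemma height_less:
  assumes "w \<in> corners" "w' \<in> corners" "w < w'"
  shows "height (col_rect w') < height (col_rect w)"
proof -
  have "column_of P w' \<subset> column_of P w"
    using corner_column[OF assms(1)] column_mono'[of "w + 1" w'] assms by (auto simp: corners_def)
  then show ?thesis
    using assms by (simp add: height_col_rect corners_def psubset_card_mono finite_column')
qed

text \<open>Columns shrink strictly at every corner, so wider maximal rectangles are lower.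
  Increasing height is therefore decreasing width, whence \<open>rev\<close>.\<close>

lemma sorted_maximal_rectangles:
  "sorted_key_list_of_set height (maximal_rectangles P) = map col_rect (rev (sorted_list_of_set corners))"
proof -
  have eq: "w = w'" if "w \<in> corners" "w' \<in> corners" "height (col_rect w) = height (col_rect w')" for w w'
    using height_less[of w w'] height_less[of w' w] that by (cases w w' rule: linorder_cases) auto
  have inj: "inj_on height (maximal_rectangles P)"
    unfolding maximal_rectangles_eq by (rule inj_onI) (auto dest: eq)
  have inj_col: "inj_on col_rect corners"
    using eq by (auto intro: inj_onI)
  let ?ws = "sorted_list_of_set corners"
  have "sorted_wrt (\<lambda>w w'. height (col_rect w') < height (col_rect w)) ?ws"
    by (rule sorted_wrt_mono_rel[OF _ strict_sorted_list_of_set])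
      (use height_less finite_corners in auto)
  then have "sorted_wrt (<) (map height (map col_rect (rev ?ws)))"
    by (simp add: sorted_wrt_map sorted_wrt_rev)
  moreover have "set (map col_rect (rev ?ws)) = maximal_rectangles P"
    using finite_corners by (simp add: maximal_rectangles_eq)
  moreover have "length (map col_rect (rev ?ws)) = card (maximal_rectangles P)"
    using card_image[OF inj_col] by (simp add: maximal_rectangles_eq)
  moreover have "finite (maximal_rectangles P)"
    using finite_corners by (simp add: maximal_rectangles_eq)
  ultimately show ?thesis
    using sorted_key_list_of_set_eqI[OF inj] by blast
qed

text \<open>Serves to replace the column of the next corner by column \<open>w + 1\<close>, which
  removes the reference to the next rectangle from the overlap terms.\<close>

lemma column_constant:
  assumes "a \<le> w" "w < z" "\<And>y. w < y \<Longrightarrow> y < z \<Longrightarrow> y \<notin> corners"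
  shows "column_of P z = column_of P (w + 1)"
proof -
  have "w + 1 \<le> z"
    using assms(2) by simp
  then show ?thesis
    using assms(3)
  proof (induction z rule: int_ge_induct)
    case base
    then show ?case by simp
  next
    case (step z)
    have "z \<notin> corners"
      using step by simp
    then have "column_of P (z + 1) = column_of P z"
      using step.hyps assms(1) by (simp add: corners_def)
    moreover have "column_of P z = column_of P (w + 1)"
      using step by simp
    ultimately show ?case
      by simp
  qed
qed

lemma maj_eq_stack_maj:
  assumes bound: "\<And>i j. (i, j) \<in> P \<Longrightarrow> j \<le> b" and S: "S \<subseteq> P" "one_per_row S"
  shows "maj P S = stack_maj a b P S"
proof -
  define ws where "ws = sorted_list_of_set corners"
  define n where "n = length ws"
  define m where "m Q = int (card (maj_triples (S \<inter> Q)))" for Q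
  define Rs where "Rs = map col_rect (rev ws)"
  have len: "length Rs = n"
    by (simp add: Rs_def n_def)
  have finS: "finite S"
    using S(1) finite_stack finite_subset by blast
  have m_rect: "int (maj_rect (column_of P v \<times> {a..w}) (S \<inter> (column_of P v \<times> {a..w}))) =
      m (column_of P v \<times> {a..w})" for v w
  proof -
    have "maj_rect (column_of P v \<times> {a..w}) (S \<inter> (column_of P v \<times> {a..w})) =
        card (maj_triples (S \<inter> (column_of P v \<times> {a..w})))"
      by (rule maj_rect_eq[OF refl connected_column])
        (use finS one_per_row_subset[OF S(2)] in auto)
    then show ?thesis
      by (simp add: m_def)
  qed
  have m_window: "m (column_of P v \<times> {a..w}) = int (card (maj_triples (S \<inter> window P v w)))" for v w
  proof -
    have "S \<inter> (column_of P v \<times> {a..w}) = S \<inter> window P v w"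
      using S(1) left_bound' by (auto simp: window_def)
    then show ?thesis
      by (simp add: m_def)
  qed
  have set_ws: "set ws = corners" and distinct: "distinct ws" and sorted: "sorted_wrt (<) ws"
    using finite_corners by (simp_all add: ws_def)
  have mem: "ws ! k \<in> corners" if "k < n" for k
    using that nth_mem set_ws by (auto simp: n_def)
  have Rs_nth: "Rs ! i = col_rect (ws ! (n - Suc i))" if "i < n" for i
    using that by (simp add: Rs_def rev_nth n_def)
  have empty: "column_of P (b + 1) = {}"
    using bound by (force simp: column_of_def)
  have corners_b: "w \<le> b" if "w \<in> corners" for w
    using corner_column[OF that] bound by (auto simp: column_of_def)
  have next_corner: "column_of P (ws ! k + 1) = column_of P (ws ! Suc k)" if "Suc k < n" for k
  proof (rule column_constant[symmetric])
    show "a \<le> ws ! k"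
      using mem[of k] that by (simp add: corners_def)
    show "ws ! k < ws ! Suc k"
      using sorted_wrt_nth_less[OF sorted, of k "Suc k"] that by (simp add: n_def)
    fix y assume y: "ws ! k < y" "y < ws ! Suc k"
    show "y \<notin> corners"
    proof
      assume "y \<in> corners"
      then obtain l where l: "l < n" "ws ! l = y"
        using set_ws by (metis in_set_conv_nth n_def)
      have "\<not> l < k" "l \<noteq> k" "\<not> Suc k < l" "l \<noteq> Suc k"
        using sorted_wrt_nth_less[OF sorted, of l k] sorted_wrt_nth_less[OF sorted, of "Suc k" l] y l that
        by (auto simp: n_def)
      then show False
        by simp
    qed
  qed
  have last_corner: "column_of P (ws ! (n - 1) + 1) = {}" if "0 < n"
  proof -
    have "column_of P (b + 1) = column_of P (ws ! (n - 1) + 1)"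
    proof (rule column_constant)
      show "a \<le> ws ! (n - 1)" "ws ! (n - 1) < b + 1"
        using mem[of "n - 1"] corners_b[of "ws ! (n - 1)"] that by (auto simp: corners_def)
      fix y assume y: "ws ! (n - 1) < y"
      show "y \<notin> corners"
      proof
        assume "y \<in> corners"
        then obtain l where l: "l < n" "ws ! l = y"
          using set_ws by (metis in_set_conv_nth n_def)
        then have "l = n - 1 \<or> l < n - 1"
          by linarith
        then show False
          using sorted_wrt_nth_less[OF sorted, of l "n - 1"] y l that
          by (auto simp: n_def)
      qed
    qed
    then show ?thesis
      using empty by simp
  qed
  define u where "u w = m (column_of P (w + 1) \<times> {a..w})" for w
  have sum_ws: "(\<Sum>k<n. h (ws ! k)) = (\<Sum>w\<in>corners. h w)" for h :: "int \<Rightarrow> int"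
    using sum.reindex_bij_betw[OF bij_betw_nth[OF distinct refl set_ws[symmetric]], of h]
    by (simp add: n_def)
  have "(\<Sum>i<n. int (maj_rect (Rs ! i) (S \<inter> Rs ! i))) = (\<Sum>i<n. m (col_rect (ws ! (n - Suc i))))"
    using m_rect by (intro sum.cong refl) (simp add: Rs_nth col_rect_def)
  also have "\<dots> = (\<Sum>k<n. m (col_rect (ws ! k)))"
    by (rule sum.nat_diff_reindex)
  also have "\<dots> = (\<Sum>w\<in>corners. m (col_rect w))"
    by (rule sum_ws)
  finally have first: "(\<Sum>i<n. int (maj_rect (Rs ! i) (S \<inter> Rs ! i))) = (\<Sum>w\<in>corners. m (col_rect w))" .
  \<comment> \<open>Since the list is reversed, \<open>Rs ! Suc i\<close> is the narrower and taller
    of the two. The overlap has the rows of the wider and the columns of the narrower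
    rectangle.\<close>
  have inter: "Rs ! i \<inter> Rs ! Suc i = column_of P (ws ! (n - 1 - Suc i) + 1) \<times> {a..ws ! (n - 1 - Suc i)}"
    if i: "i < n - 1" for i
  proof -
    define k where "k = n - 1 - Suc i"
    have k: "n - Suc i = Suc k" "n - Suc (Suc i) = k" "Suc k < n"
      using i by (auto simp: k_def)
    have "ws ! k < ws ! Suc k"
      using sorted_wrt_nth_less[OF sorted, of k "Suc k"] k by (simp add: n_def)
    moreover have "column_of P (ws ! Suc k) \<subseteq> column_of P (ws ! k)"
      using column_mono'[of "ws ! k" "ws ! Suc k"] calculation mem[of k] k by (simp add: corners_def)
    moreover have "Rs ! i = col_rect (ws ! Suc k)" "Rs ! Suc i = col_rect (ws ! k)"
      using Rs_nth[of i] Rs_nth[of "Suc i"] i k by auto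
    ultimately show ?thesis
      using next_corner[OF k(3)] unfolding k_def[symmetric] by (auto simp: col_rect_def)
  qed
  have "(\<Sum>i<n - 1. int (maj_rect (Rs ! i \<inter> Rs ! Suc i) (S \<inter> (Rs ! i \<inter> Rs ! Suc i)))) =
      (\<Sum>i<n - 1. u (ws ! (n - 1 - Suc i)))"
    by (intro sum.cong refl) (simp only: inter m_rect u_def lessThan_iff)
  also have "\<dots> = (\<Sum>k<n - 1. u (ws ! k))"
    by (rule sum.nat_diff_reindex)
  also have "\<dots> = (\<Sum>k<n. u (ws ! k))"
  proof (cases n)
    case (Suc n')
    \<comment> \<open>The widest rectangle has no wider neighbour, but the column after it is empty.
      Its additional overlap term is 0, so both sums can run over all corners.\<close>
    have "u (ws ! n') = 0"
      using last_corner by (simp add: u_def Suc m_def)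
    then show ?thesis
      by (simp add: Suc)
  qed simp
  also have "\<dots> = (\<Sum>w\<in>corners. u w)"
    by (rule sum_ws)
  finally have "maj P S = (\<Sum>w\<in>corners. m (col_rect w)) - (\<Sum>w\<in>corners. u w)"
    using first unfolding maj_def sorted_maximal_rectangles Let_def ws_def[symmetric] Rs_def[symmetric] len
    by simp
  also have "\<dots> = (\<Sum>w\<in>corners. m (column_of P w \<times> {a..w}) - m (column_of P (w + 1) \<times> {a..w}))"
    by (simp add: sum_subtractf col_rect_def u_def)
  also have "\<dots> = (\<Sum>w=a..b. m (column_of P w \<times> {a..w}) - m (column_of P (w + 1) \<times> {a..w}))"
  proof (rule sum.mono_neutral_left)
    show "corners \<subseteq> {a..b}"
      using corners_b by (force simp: corners_def)
    show "\<forall>w\<in>{a..b} - corners. m (column_of P w \<times> {a..w}) - m (column_of P (w + 1) \<times> {a..w}) = 0"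
      by (simp add: corners_def)
  qed simp
  also have "\<dots> = stack_maj a b P S"
    unfolding stack_maj_def m_window ..
  finally show ?thesis .
qed

text \<open>Column \<open>snd x\<close> contains the corner and the upper cell, hence all rows
  between, and each such row extends from there leftwards to column \<open>a\<close>.\<close>

lemma ne_eq_card_ne_chains:
  assumes "T \<subseteq> P"
  shows "ne P T = card (ne_chains P T)"
proof -
  have "is_NE_chain P x y \<longleftrightarrow> fst x < fst y \<and> snd y < snd x \<and> (fst y, snd x) \<in> P"
    if "x \<in> T" "y \<in> T" for x y
  proof
    assume *: "fst x < fst y \<and> snd y < snd x \<and> (fst y, snd x) \<in> P"
    have x: "(fst x, snd x) \<in> P" and y: "(fst y, snd y) \<in> P"
      using assms that by auto
    have "(i, j) \<in> P" if "i \<in> {fst x..fst y}" "j \<in> {snd y..snd x}" for i j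
    proof -
      have "fst x \<in> column_of P (snd x)" "fst y \<in> column_of P (snd x)"
        using x * by (auto simp: column_of_def)
      then have "i \<in> column_of P (snd x)"
        using connected_column that(1) unfolding connected_line_def by blast
      then show ?thesis
        using row_closed[of i "snd x" j] left_bound'[OF y] that(2) by (simp add: column_of_def)
    qed
    then show "is_NE_chain P x y"
      using * by (auto simp: is_NE_chain_def)
  qed (auto simp: is_NE_chain_def)
  then have "{(x, y). x \<in> T \<and> y \<in> T \<and> is_NE_chain P x y} = ne_chains P T"
    by (auto simp: ne_chains_def)
  then show ?thesis
    by (simp add: ne_def)
qed

end

lemma left_aligned_stack_full_stack:
  assumes "left_aligned_stack P"
  obtains a where "full_stack P a"
proof -
  obtain a where a: "\<And>i j. (i, j) \<in> P \<Longrightarrow> a \<le> j \<and> (i, a) \<in> P"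
    using assms unfolding left_aligned_stack_def left_aligned_def by blast
  have conv: "finite P" "connected_line (row_of P i)" "connected_line (column_of P j)" for i j
    using assms by (auto simp: left_aligned_stack_def moon_polyomino_def convex_polyomino_def)
  have "full_stack P a"
  proof
    show "finite P"
      by (rule conv(1))
    show "a \<le> j" if "(i, j) \<in> P" for i j
      using a that by blast
    show "(i, j') \<in> P" if "(i, j) \<in> P" "a \<le> j'" "j' \<le> j" for i j j'
    proof -
      have "{a..j} \<subseteq> row_of P i"
        using conv(2)[of i] a[OF that(1)] that(1) unfolding connected_line_def row_of_def by blast
      then show ?thesis
        using that by (auto simp: row_of_def)
    qed
    show "(m, j) \<in> P" if "(i, j) \<in> P" "(k, j) \<in> P" "m \<in> rows P" "i \<le> m" "m \<le> k" for i j k m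
    proof -
      have "{i..k} \<subseteq> column_of P j"
        using conv(3)[of j] that(1,2) unfolding connected_line_def column_of_def by blast
      then show ?thesis
        using that by (auto simp: column_of_def)
    qed
    have "rows P = column_of P a"
      using a by (auto simp: rows_iff column_of_def)
    then show "connected_line (rows P)"
      using conv(3) by simp
  qed
  then show thesis
    by (rule that)
qed

section \<open>Deleting and reinserting empty rows\<close>

lemma row_rank_less_iff:
  assumes "finite K" "i \<in> K" "k \<in> K"
  shows "row_rank K i < row_rank K k \<longleftrightarrow> i < k"
proof -
  have "row_rank K i < row_rank K k" if "i < k" "i \<in> K" for i k
    using that assms(1) unfolding row_rank_def
    by (intro of_nat_less_iff[THEN iffD2] psubset_card_mono) auto
  then show ?thesis
    using assms by (metis linorder_neqE_linordered_idom order_less_asym order_less_irrefl)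
qed

text \<open>The renumbered rows form an interval, which provides the connectedness required by
  \<open>full_stack\<close>.\<close>

lemma row_rank_image:
  assumes "finite K"
  shows "row_rank K ` K = {0..<int (card K)}"
proof (rule card_subset_eq)
  show "row_rank K ` K \<subseteq> {0..<int (card K)}"
  proof clarify
    fix k assume "k \<in> K"
    then have "card {i \<in> K. i < k} < card K"
      using assms by (intro psubset_card_mono) auto
    then show "row_rank K k \<in> {0..<int (card K)}"
      by (simp add: row_rank_def)
  qed
  have "inj_on (row_rank K) K"
    using row_rank_less_iff[OF assms] by (metis inj_onI linorder_neqE_linordered_idom order_less_irrefl)
  then show "card (row_rank K ` K) = card {0..<int (card K)}"
    by (simp add: card_image)
qed simp

text \<open>Chains and triples depend on the rows only through their order and, for chains, through
  membership of the corner. So every strictly monotone renumbering of the nonempty rows preserves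
  their number.\<close>

locale row_renumbering =
  fixes K :: "int set" and \<rho> :: "int \<Rightarrow> int"
  assumes mono: "i \<in> K \<Longrightarrow> k \<in> K \<Longrightarrow> \<rho> i < \<rho> k \<longleftrightarrow> i < k"
begin

lemma le_iff: "i \<in> K \<Longrightarrow> k \<in> K \<Longrightarrow> \<rho> i \<le> \<rho> k \<longleftrightarrow> i \<le> k"
  using mono by (meson leD leI)

lemma inj: "i \<in> K \<Longrightarrow> k \<in> K \<Longrightarrow> \<rho> i = \<rho> k \<longleftrightarrow> i = k"
  using le_iff by (metis order_antisym order_refl)

definition shift :: "cell \<Rightarrow> cell" where
  "shift x = (\<rho> (fst x), snd x)"

lemma fst_shift [simp]: "fst (shift x) = \<rho> (fst x)" and snd_shift [simp]: "snd (shift x) = snd x"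
  by (simp_all add: shift_def)

lemma inj_shift: "X \<subseteq> K \<times> UNIV \<Longrightarrow> inj_on shift X"
  using inj by (fastforce simp: inj_on_def shift_def)

lemma card_maj_triples_shift:
  assumes X: "X \<subseteq> K \<times> UNIV"
  shows "card (maj_triples (shift ` X)) = card (maj_triples X)"
proof -
  have K: "fst x \<in> K" if "x \<in> X" for x
    using X that by auto
  have "(shift x, shift y) \<in> descents (shift ` X) \<longleftrightarrow> (x, y) \<in> descents X" if "x \<in> X" "y \<in> X" for x y
    using that K mono by (simp add: descents_def)
  then have triple: "(shift x, shift y, shift z) \<in> maj_triples (shift ` X) \<longleftrightarrow> (x, y, z) \<in> maj_triples X"
    if "x \<in> X" "y \<in> X" "z \<in> X" for x y z
    using that K le_iff by (simp add: maj_triples_def)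
  have in_X: "x \<in> Y \<and> y \<in> Y \<and> z \<in> Y" if "(x, y, z) \<in> maj_triples Y" for x y z Y
    using that by (auto simp: maj_triples_def descents_def)
  have "maj_triples (shift ` X) = (\<lambda>(x, y, z). (shift x, shift y, shift z)) ` maj_triples X"
  proof (intro equalityI subsetI)
    fix t assume "t \<in> maj_triples (shift ` X)"
    moreover obtain x' y' z' where "t = (x', y', z')"
      by (metis prod_cases3)
    ultimately obtain x y z where "x \<in> X" "y \<in> X" "z \<in> X" "t = (shift x, shift y, shift z)"
        "t \<in> maj_triples (shift ` X)"
      using in_X[of x' y' z' "shift ` X"] by blast
    then show "t \<in> (\<lambda>(x, y, z). (shift x, shift y, shift z)) ` maj_triples X"
      using triple[of x y z] by force
  next
    fix t assume "t \<in> (\<lambda>(x, y, z). (shift x, shift y, shift z)) ` maj_triples X"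
    then obtain x y z where "(x, y, z) \<in> maj_triples X" "t = (shift x, shift y, shift z)"
      by auto
    then show "t \<in> maj_triples (shift ` X)"
      using triple[of x y z] in_X[of x y z X] by simp
  qed
  moreover have "inj_on (\<lambda>(x, y, z). (shift x, shift y, shift z)) (X \<times> X \<times> X)"
    using inj_shift[OF X] by (auto simp: inj_on_def)
  then have "inj_on (\<lambda>(x, y, z). (shift x, shift y, shift z)) (maj_triples X)"
    by (rule inj_on_subset) (auto dest: in_X)
  ultimately show ?thesis
    by (simp add: card_image)
qed

lemma card_ne_chains_shift:
  assumes X: "X \<subseteq> K \<times> UNIV" and Q: "\<And>i j. i \<in> K \<Longrightarrow> (\<rho> i, j) \<in> Q \<longleftrightarrow> (i, j) \<in> P"
  shows "card (ne_chains Q (shift ` X)) = card (ne_chains P X)"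
proof -
  have K: "fst x \<in> K" if "x \<in> X" for x
    using X that by auto
  have pair: "(shift x, shift y) \<in> ne_chains Q (shift ` X) \<longleftrightarrow> (x, y) \<in> ne_chains P X" if "x \<in> X" "y \<in> X" for x y
    using that K mono Q by (simp add: ne_chains_def)
  have in_X: "x \<in> Y \<and> y \<in> Y" if "(x, y) \<in> ne_chains R Y" for x y R Y
    using that by (auto simp: ne_chains_def)
  have "ne_chains Q (shift ` X) = (\<lambda>(x, y). (shift x, shift y)) ` ne_chains P X"
  proof (intro equalityI subsetI)
    fix t assume "t \<in> ne_chains Q (shift ` X)"
    moreover obtain x' y' where "t = (x', y')"
      by (cases t)
    ultimately obtain x y where "x \<in> X" "y \<in> X" "t = (shift x, shift y)" "t \<in> ne_chains Q (shift ` X)"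
      using in_X[of x' y' Q "shift ` X"] by blast
    then show "t \<in> (\<lambda>(x, y). (shift x, shift y)) ` ne_chains P X"
      using pair[of x y] by force
  next
    fix t assume "t \<in> (\<lambda>(x, y). (shift x, shift y)) ` ne_chains P X"
    then obtain x y where "(x, y) \<in> ne_chains P X" "t = (shift x, shift y)"
      by auto
    then show "t \<in> ne_chains Q (shift ` X)"
      using pair[of x y] in_X[of x y P X] by simp
  qed
  moreover have "inj_on (\<lambda>(x, y). (shift x, shift y)) (X \<times> X)"
    using inj_shift[OF X] by (auto simp: inj_on_def)
  then have "inj_on (\<lambda>(x, y). (shift x, shift y)) (ne_chains P X)"
    by (rule inj_on_subset) (auto dest: in_X)
  ultimately show ?thesis
    by (simp add: card_image)
qed

end

theorem theorem5p7:
  fixes P M :: "(int \<times> int) set"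
  assumes "left_aligned_stack P"
    and "filling P M"
  shows "maj P M = int (ne P (phi P M))"
proof -
  obtain a where "full_stack P a"
    using left_aligned_stack_full_stack[OF assms(1)] .
  then interpret full_stack P a .
  have M: "M \<subseteq> P" "one_per_row M"
    using assms(2) by (auto simp: filling_def one_per_row_def)
  obtain b where b: "\<And>i j. (i, j) \<in> P \<Longrightarrow> j \<le> b"
  proof
    show "j \<le> Max (snd ` P)" if "(i, j) \<in> P" for i j
      using that finite_stack by (intro Max_ge) force+
  qed
  define K where "K = rows M"
  define \<rho> where "\<rho> = row_rank K"
  define P' where "P' = keep_rows K P"
  define M' where "M' = keep_rows K M"
  define T where "T = phi_nonempty P' M'"
  have K: "K \<subseteq> rows P"
    using M(1) by (auto simp: K_def rows_def)
  then have finK: "finite K"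
    using finite_rows_P finite_subset by blast
  interpret row_renumbering K \<rho>
    unfolding \<rho>_def by unfold_locales (rule row_rank_less_iff[OF finK])
  have keep: "(\<rho> i, j) \<in> keep_rows K Q \<longleftrightarrow> (i, j) \<in> Q" if "i \<in> K" for i j Q
    using that inj unfolding keep_rows_def \<rho>_def[symmetric] by auto
  have keep_image: "\<exists>k\<in>K. i = \<rho> k \<and> (k, j) \<in> Q" if "(i, j) \<in> keep_rows K Q" for i j Q
    using that unfolding keep_rows_def \<rho>_def[symmetric] by blast
  have rows_P': "rows P' = \<rho> ` K" and rows_M': "rows M' = \<rho> ` K"
    using K keep keep_image unfolding P'_def M'_def K_def[symmetric] rows_iff set_eq_iff
    by (auto simp: image_iff rows_iff K_def) (metis rows_iff subsetD)+
  \<comment> \<open>Deleting empty rows may change the maximal rectangles, but each window only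
    loses rows without 1-cells. Hence the sum over widths is the same before and after.\<close>
  have M'_shift: "M' \<inter> window P' v w = shift ` (M \<inter> window P v w)" for v w
  proof -
    have "shift x \<in> M' \<inter> window P' v w" if "x \<in> M \<inter> window P v w" for x
      using that keep mem_rows[of "fst x" "snd x" M]
      by (cases x) (auto simp: shift_def M'_def P'_def K_def)
    moreover have "x \<in> shift ` (M \<inter> window P v w)" if x: "x \<in> M' \<inter> window P' v w" for x
    proof -
      obtain k where k: "k \<in> K" "fst x = \<rho> k" "(k, snd x) \<in> M"
        using keep_image[of "fst x" "snd x" M] x by (auto simp: M'_def)
      have "(\<rho> k, v) \<in> P'" "snd x \<le> w"
        using x k(2) by (cases x; auto)+
      then have "(k, snd x) \<in> M \<inter> window P v w" "x = shift (k, snd x)"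
        using k keep by (auto simp: P'_def shift_def prod_eq_iff)
      then show ?thesis
        by blast
    qed
    ultimately show ?thesis
      by blast
  qed
  have full': "full_stack P' a"
  proof
    have "P' = shift ` (P \<inter> K \<times> UNIV)"
      unfolding P'_def keep_rows_def \<rho>_def[symmetric] shift_def by force
    then show "finite P'"
      using finite_stack by simp
    show "a \<le> j" if "(i, j) \<in> P'" for i j
      using keep_image[of i j P] left_bound' that by (auto simp: P'_def)
    show "(i, j') \<in> P'" if "(i, j) \<in> P'" "a \<le> j'" "j' \<le> j" for i j j'
      using keep_image[of i j P] keep row_closed that by (auto simp: P'_def)
    show "(m, j) \<in> P'" if m: "(i, j) \<in> P'" "(k, j) \<in> P'" "m \<in> rows P'" "i \<le> m" "m \<le> k" for i j k m
    proof -
      obtain i0 k0 m0 where "i0 \<in> K" "i = \<rho> i0" "(i0, j) \<in> P" "k0 \<in> K" "k = \<rho> k0" "(k0, j) \<in> P"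
          "m0 \<in> K" "m = \<rho> m0"
        using keep_image m(1,2,3) rows_P' unfolding P'_def by blast
      then show ?thesis
        using column_convex[of i0 j k0 m0] m(4,5) K keep le_iff by (auto simp: P'_def)
    qed
    show "connected_line (rows P')"
      unfolding rows_P' \<rho>_def row_rank_image[OF finK] by (auto simp: connected_line_def)
  qed
  have "phi_spec a b P' M' T"
    unfolding T_def
  proof (rule phi_nonempty_spec[OF full'])
    show "\<forall>(i, j)\<in>P'. j \<le> b"
      using keep_image b by (fastforce simp: P'_def)
    show "M' \<subseteq> P'"
      using keep_image[of _ _ M] keep M(1) by (fastforce simp: M'_def P'_def)
    show "one_per_row M'"
      using keep_image[of _ _ M] inj M(2) unfolding one_per_row_def M'_def by (metis keep)
    show "rows M' = rows P'"
      by (simp add: rows_M' rows_P')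
  qed
  then have T: "T \<subseteq> P'" "stack_maj a b P' M' = int (card (ne_chains P' T))"
    by (simp_all add: phi_spec_def)
  define X where "X = phi P M"
  have mem_X: "(i, j) \<in> X \<longleftrightarrow> i \<in> K \<and> (\<rho> i, j) \<in> T" for i j
    by (simp add: X_def phi_def reinsert_rows_def K_def[symmetric] \<rho>_def[symmetric] P'_def[symmetric]
        M'_def[symmetric] T_def[symmetric])
  have XK: "X \<subseteq> K \<times> UNIV"
    using mem_X by auto
  have XP: "X \<subseteq> P"
    using mem_X T(1) keep unfolding P'_def by fastforce
  \<comment> \<open>Every row of \<open>P'\<close> is the new index of a row in \<open>K\<close>, so
    reinsertion loses no cell of \<open>T\<close>.\<close>
  have "shift ` X = T"
  proof -
    have "x \<in> shift ` X" if "x \<in> T" for x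
    proof -
      have "(fst x, snd x) \<in> P'"
        using that T(1) by auto
      then obtain k where "k \<in> K" "fst x = \<rho> k"
        using keep_image unfolding P'_def by blast
      then have "(k, snd x) \<in> X" "x = shift (k, snd x)"
        using that mem_X by (auto simp: shift_def prod_eq_iff) (metis prod.collapse)
      then show ?thesis
        by blast
    qed
    then show ?thesis
      using mem_X by (auto simp: shift_def)
  qed
  then have "card (ne_chains P' T) = card (ne_chains P X)"
    using card_ne_chains_shift[OF XK, of P' P] keep by (simp add: P'_def)
  moreover have "stack_maj a b P' M' = stack_maj a b P M"
  proof -
    have "M \<inter> window P v w \<subseteq> K \<times> UNIV" for v w
      using mem_rows by (auto simp: K_def)
    then show ?thesis
      unfolding stack_maj_def M'_shift by (simp add: card_maj_triples_shift)
  qed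
  ultimately show ?thesis
    using T(2) maj_eq_stack_maj[OF b M] ne_eq_card_ne_chains[OF XP] by (simp add: X_def)
qed

end
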